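(* Let $n\ge2$ and let $z_1,z_2 \in \mathbb{R}^n$. If $\gamma: X \to \mathbb{R}^n$ is any generalized path such that $z_1,z_2 \in \gamma(X)$, then $\mathsf{len}(\overline{z_1 z_2}) \leq \mathsf{len}(\gamma)$. Moreover, if $\gamma(X)$ is not the straight line segment joining $z_1$ and $z_2$, or if $\gamma^{-1}(w)$ is disconnected for some $w$ on the straight line segment between $z_1$ and $z_2$, then $\mathsf{len}(\overline{z_1 z_2}) < \mathsf{len}(\gamma)$.
   Context: $\overline{z_1z_2}$ denotes the straight line segment path $t\mapsto(1-t)z_1+tz_2$, $t\in[0,1]$. A continuum is a nonempty compact connected metric space. A generalized path is a continuous map $\gamma: X\to\mathbb{R}^n$ where $X$ is a locally connected metric continuum. Definition of $\mathsf{len}=\mathsf{len}_n$. For a unit vector $u\in \mathbb{S}^{n-1}$, $x\in[0,1]$, $\mu\in(0,1]$ and $j\in\mathbb{Z}$ put $S_j^{x,u,\mu}=\{z\in\mathbb{R}^n: \mu(j+x)\le\langle z,u\rangle\le\mu(j+1+x)\}$, and for $A\subset\mathbb{R}^n$ put $\|A\|_u=\mathrm{diam}\{\langle z,u\rangle: z\in A\}$. Given a generalized path $\gamma:X\to\mathbb{R}^n$, let $C_0,C_1,C_2,\ldots$ (a finite or infinite list) enumerate all connected components $C$ of the sets $\gamma^{-1}(S_j^{x,u,\mu})$, $j\in\mathbb{Z}$, for which $\|\gamma(C)\|_u>0$, ordered so that $\|\gamma(C_k)\|_u\ge\|\gamma(C_{k+1})\|_u$ for all $k$ (this is possible, since for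 each $\varepsilon>0$ only finitely many such components have $\|\gamma(C)\|_u\ge\varepsilon$). Put $L^{x,u,\mu}(\gamma)=\sum_{k\ge0}2^{-k}\|\gamma(C_k)\|_u$ (missing terms count as $0$), and $$\mathsf{len}(\gamma)=\int_0^1\int_{\mathbb{S}^{n-1}}\int_0^1 L^{x,u,\mu}(\gamma)\,dx\,d\sigma(u)\,d\mu,$$ where $\sigma$ is the rotation-invariant probability measure on $\mathbb{S}^{n-1}$. (Replacing $u$ by $-u$ does not change the integral over $x$, so equivalently one integrates over $(n-1)$-dimensional real projective space; for $n=2$, identifying $\mathbb{R}^2$ with $\mathbb{C}$, one may take $u=ie^{t\pi i}$ and integrate $dt$ over $t\in[0,1]$.) *)

theory Defs
  imports "HOL-Analysis.Analysis"
begin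

definition generalized_path :: "'a::metric_space set \<Rightarrow> ('a \<Rightarrow> 'b::euclidean_space) \<Rightarrow> bool" where
  "generalized_path X \<gamma> \<longleftrightarrow>
     X \<noteq> {} \<and> compact X \<and> connected X \<and> locally connected X \<and> continuous_on X \<gamma>"

definition slab :: "real \<Rightarrow> 'b::euclidean_space \<Rightarrow> real \<Rightarrow> int \<Rightarrow> 'b set" where
  "slab x u \<mu> j = {z. \<mu> * (of_int j + x) \<le> z \<bullet> u \<and> z \<bullet> u \<le> \<mu> * (of_int j + 1 + x)}"

definition width :: "'b::euclidean_space \<Rightarrow> 'b set \<Rightarrow> real" where
  "width u A = diameter ((\<lambda>z. z \<bullet> u) ` A)"

text \<open>A set cannot be a component for two different \<open>j\<close> and have positive width, as its image
  would lie in a hyperplane orthogonal to \<open>u\<close>; so collecting the components over all \<open>j\<close>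
  into one set does not merge any of them.\<close>

definition slab_components ::
  "'a::metric_space set \<Rightarrow> ('a \<Rightarrow> 'b::euclidean_space) \<Rightarrow> real \<Rightarrow> 'b \<Rightarrow> real \<Rightarrow> 'a set set" where
  "slab_components X \<gamma> x u \<mu> =
     {C. (\<exists>j. C \<in> components {p \<in> X. \<gamma> p \<in> slab x u \<mu> j}) \<and> width u (\<gamma> ` C) > 0}"

definition decreasing_enumeration :: "('c \<Rightarrow> real) \<Rightarrow> 'c set \<Rightarrow> enat \<Rightarrow> (nat \<Rightarrow> 'c) \<Rightarrow> bool" where
  "decreasing_enumeration w F N c \<longleftrightarrow>
     bij_betw c {k. enat k < N} F \<and>
     (\<forall>k l. k \<le> l \<longrightarrow> enat l < N \<longrightarrow> w (c l) \<le> w (c k))"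

definition slab_length ::
  "'a::metric_space set \<Rightarrow> ('a \<Rightarrow> 'b::euclidean_space) \<Rightarrow> real \<Rightarrow> 'b \<Rightarrow> real \<Rightarrow> ennreal" where
  "slab_length X \<gamma> x u \<mu> =
     (let w = (\<lambda>C. width u (\<gamma> ` C));
          (N, c) = (SOME (N, c). decreasing_enumeration w (slab_components X \<gamma> x u \<mu>) N c)
      in \<Sum>k. if enat k < N then ennreal ((1/2) ^ k * w (c k)) else 0)"

text \<open>The rotation-invariant probability measure on the unit sphere, as the radial projection
  of the uniform distribution on the unit ball (the origin, where \<^term>\<open>sgn\<close> is \<open>0\<close>, is a
  null set). See \<open>emeasure_sphere_measure_space\<close> and \<open>sphere_measure_rotation_invariant\<close>.\<close>

definition sphere_measure :: "'b::euclidean_space measure" where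
  "sphere_measure =
     restrict_space (distr (uniform_measure lborel (ball 0 1)) borel sgn) (sphere 0 1)"

definition len :: "'a::metric_space set \<Rightarrow> ('a \<Rightarrow> 'b::euclidean_space) \<Rightarrow> ennreal" where
  "len X \<gamma> =
     (\<integral>\<^sup>+\<mu>\<in>{0<..1}. (\<integral>\<^sup>+u. (\<integral>\<^sup>+x\<in>{0..1}. slab_length X \<gamma> x u \<mu> \<partial>lborel) \<partial>sphere_measure) \<partial>lborel)"


subsection \<open>The measure on the sphere\<close>

lemma borel_measurable_sgn_euclidean [measurable]:
  "(sgn :: 'b::euclidean_space \<Rightarrow> 'b) \<in> borel_measurable borel"
  unfolding sgn_div_norm by measurable

lemma space_sphere_measure [simp]: "space (sphere_measure :: 'b::euclidean_space measure) = sphere 0 1"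
  by (simp add: sphere_measure_def space_restrict_space)

lemma sets_sphere_measure [measurable_cong]:
  "sets (sphere_measure :: 'b::euclidean_space measure) = sets (restrict_space borel (sphere 0 1))"
  unfolding sphere_measure_def by (intro sets_restrict_space_cong) simp

lemma emeasure_sphere_measure:
  fixes A :: "'b::euclidean_space set"
  assumes "A \<in> sets borel" "A \<subseteq> sphere 0 1"
  shows "emeasure sphere_measure A =
    emeasure lborel (ball 0 1 \<inter> sgn -` A) / emeasure lborel (ball (0::'b) 1)"
proof -
  have "emeasure (sphere_measure :: 'b measure) A =
      emeasure (distr (uniform_measure lborel (ball 0 1)) borel sgn) A"
    unfolding sphere_measure_def by (rule emeasure_restrict_space) (use assms in auto)
  also have "\<dots> = emeasure (uniform_measure lborel (ball 0 1)) (sgn -` A)"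
    using assms by (subst emeasure_distr) auto
  also have "\<dots> = emeasure lborel (ball 0 1 \<inter> sgn -` A) / emeasure lborel (ball (0::'b) 1)"
    by (rule emeasure_uniform_measure)
       (use assms(1) measurable_sets_borel[OF borel_measurable_sgn_euclidean] in auto)
  finally show ?thesis .
qed

lemma emeasure_sphere_measure_space:
  "emeasure (sphere_measure :: 'b::euclidean_space measure) (sphere 0 1) = 1"
proof -
  have *: "ball 0 1 \<inter> sgn -` sphere 0 1 = ball (0::'b) 1 - {0}"
    by (auto simp: norm_sgn)
  have "emeasure lborel (ball (0::'b) 1 - {0}) = emeasure lborel (ball (0::'b) 1)"
    by (intro emeasure_Diff_null_set) auto
  moreover have "emeasure lborel (ball (0::'b) 1) \<noteq> 0" "emeasure lborel (ball (0::'b) 1) \<noteq> \<infinity>"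
    by (auto simp: emeasure_ball less_imp_le unit_ball_vol_pos less_imp_neq[OF unit_ball_vol_pos, symmetric])
  ultimately show ?thesis
    by (subst emeasure_sphere_measure) (auto simp: * ennreal_divide_self less_top)
qed

lemma emeasure_lborel_orthogonal_vimage_open_ge:
  fixes T :: "'b::euclidean_space \<Rightarrow> 'b"
  assumes T: "orthogonal_transformation T" and S: "open S"
  shows "emeasure lborel S \<le> emeasure lborel (T -` S)"
proof -
  define K where "K = {(x, r::real). 0 < r \<and> cball x r \<subseteq> S}"
  define T' where "T' = inv T"
  have T': "orthogonal_transformation T'"
    unfolding T'_def by (rule orthogonal_transformation_inv[OF T])
  have bij: "bij T" using T by (rule orthogonal_transformation_bij)
  have im: "T -` cball x r = cball (T' x) r" for x r
  proof -
    have "dist (T' x) y = dist x (T y)" for y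
    proof -
      have "dist (T (T' x)) (T y) = dist (T' x) y"
        using T orthogonal_transformation_isometry by blast
      then show ?thesis using bij by (simp add: T'_def bij_is_surj surj_f_inv_f)
    qed
    then show ?thesis by auto
  qed
  obtain C where C: "countable C" "C \<subseteq> K"
    and pw: "pairwise (\<lambda>i j. disjnt (cball (fst i) (snd i)) (cball (fst j) (snd j))) C"
    and neg: "negligible (S - (\<Union>i\<in>C. cball (fst i) (snd i)))"
  proof (rule Vitali_covering_theorem_cballs[of K snd S fst])
    show "0 < snd i" if "i \<in> K" for i using that by (auto simp: K_def)
  next
    fix x and d :: real assume "x \<in> S" "0 < d"
    then obtain e where "e > 0" "cball x e \<subseteq> S" using S open_contains_cball by blast
    then show "\<exists>i. i \<in> K \<and> x \<in> cball (fst i) (snd i) \<and> snd i < d"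
      using \<open>0 < d\<close>
      by (intro exI[of _ "(x, min e (d/2))"]) (auto simp: K_def)
  qed auto
  let ?U = "\<Union>i\<in>C. cball (fst i) (snd i)"
  have U: "?U \<in> sets borel" using C by (intro sets.countable_UN'') auto
  have V: "(\<Union>i\<in>C. cball (T' (fst i)) (snd i)) \<in> sets borel" using C by (intro sets.countable_UN'') auto
  have "S - ?U \<in> sets borel" using U S by auto
  then have N: "S - ?U \<in> null_sets lborel"
    using neg negligible_iff_null_sets null_sets_completion_iff by (metis sets_lborel)
  have "S = ?U \<union> (S - ?U)" using C by (fastforce simp: K_def)
  then have "emeasure lborel S = emeasure lborel (?U \<union> (S - ?U))" by simp
  also have "\<dots> = emeasure lborel ?U"
    using N U by (intro emeasure_Un_null_set) auto
  also have "\<dots> = (\<integral>\<^sup>+i. emeasure lborel (cball (fst i) (snd i)) \<partial>count_space C)"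
    using pw C by (intro emeasure_UN_countable) (auto simp: disjoint_family_on_def pairwise_def disjnt_def)
  also have "\<dots> = (\<integral>\<^sup>+i. emeasure lborel (cball (T' (fst i)) (snd i)) \<partial>count_space C)"
    using C by (intro nn_integral_cong) (auto simp: K_def emeasure_cball)
  also have "\<dots> = emeasure lborel (\<Union>i\<in>C. cball (T' (fst i)) (snd i))"
  proof (rule emeasure_UN_countable[symmetric])
    show "disjoint_family_on (\<lambda>i. cball (T' (fst i)) (snd i)) C"
      using pw unfolding im[symmetric] disjoint_family_on_def pairwise_def disjnt_def by blast
  qed (use C in auto)
  also have "\<dots> \<le> emeasure lborel (T -` S)"
  proof (rule emeasure_mono)
    show "(\<Union>i\<in>C. cball (T' (fst i)) (snd i)) \<subseteq> T -` S"
      using C unfolding im[symmetric] K_def by fastforce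
    have "continuous_on UNIV T"
      using orthogonal_transformation_linear[OF T] by (simp add: linear_continuous_on linear_linear)
    then have "open (T -` S)" using S by (simp add: open_vimage)
    then show "T -` S \<in> sets lborel" by simp
  qed
  finally show ?thesis .
qed

lemma emeasure_lborel_orthogonal_vimage:
  fixes T :: "'b::euclidean_space \<Rightarrow> 'b"
  assumes T: "orthogonal_transformation T" and A: "A \<in> sets borel"
  shows "emeasure lborel (T -` A) = emeasure lborel A"
proof -
  have contT: "continuous_on UNIV T"
    using orthogonal_transformation_linear[OF T] by (simp add: linear_continuous_on linear_linear)
  then have mT [measurable]: "T \<in> borel_measurable borel"
    by (rule borel_measurable_continuous_onI)
  have bij: "bij T" using T by (rule orthogonal_transformation_bij)
  have op: "emeasure lborel (T -` S) = emeasure lborel S" if S: "open S" for S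
  proof (rule antisym)
    have "open (T -` S)" using contT S by (simp add: open_vimage)
    from emeasure_lborel_orthogonal_vimage_open_ge[OF orthogonal_transformation_inv[OF T] this]
    show "emeasure lborel (T -` S) \<le> emeasure lborel S"
      using bij by (simp add: vimage_def bij_is_surj surj_f_inv_f)
    show "emeasure lborel S \<le> emeasure lborel (T -` S)"
      by (rule emeasure_lborel_orthogonal_vimage_open_ge[OF T S])
  qed
  have eq: "lborel = distr lborel borel T"
  proof (rule measure_eqI_generator_eq[where E = "{S. open S}" and \<Omega> = UNIV and A = "\<lambda>n::nat. ball 0 n"])
    show "emeasure lborel S = emeasure (distr lborel borel T) S" if "S \<in> {S. open S}" for S
      using that op[of S] by (simp add: emeasure_distr)
    show "(\<Union>n::nat. ball (0::'b) n) = UNIV"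
      using reals_Archimedean2 by auto
  qed (auto simp: Int_stable_def borel_def emeasure_ball)
  have "emeasure (distr lborel borel T) A = emeasure lborel (T -` A)"
    using A by (simp add: emeasure_distr)
  then show ?thesis using eq by simp
qed

lemma sphere_measure_rotation_invariant:
  fixes T :: "'b::euclidean_space \<Rightarrow> 'b"
  assumes T: "orthogonal_transformation T"
  shows "distr sphere_measure sphere_measure T = sphere_measure"
proof (rule measure_eqI)
  have contT: "continuous_on UNIV T"
    using orthogonal_transformation_linear[OF T] by (simp add: linear_continuous_on linear_linear)
  then have mT [measurable]: "T \<in> borel_measurable borel"
    by (rule borel_measurable_continuous_onI)
  have nT: "norm (T x) = norm x" for x
    by (rule orthogonal_transformation_norm[OF T])
  have sT: "sgn (T x) = T (sgn x)" for x
    using orthogonal_transformation_linear[OF T] by (simp add: sgn_div_norm nT linear_scale)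
  have mT': "T \<in> measurable sphere_measure sphere_measure"
    unfolding measurable_cong_sets[OF sets_sphere_measure sets_sphere_measure]
    by (intro measurable_restrict_space3) (auto simp: nT)
  fix A assume "A \<in> sets (distr sphere_measure sphere_measure T)"
  then have A: "A \<in> sets borel" "A \<subseteq> sphere 0 1"
    by (auto simp: sets_sphere_measure sets_restrict_space_iff)
  have TA: "T -` A \<in> sets borel" "T -` A \<subseteq> sphere 0 1"
    using A measurable_sets_borel[OF mT A(1)] by (auto simp: nT dest!: subsetD)
  have "emeasure (distr sphere_measure sphere_measure T) A = emeasure sphere_measure (T -` A)"
    using A TA mT' by (subst emeasure_distr) (auto simp: sets_sphere_measure sets_restrict_space_iff Int_absorb2)
  also have "\<dots> = emeasure lborel (ball 0 1 \<inter> sgn -` T -` A) / emeasure lborel (ball (0::'b) 1)"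
    by (rule emeasure_sphere_measure[OF TA])
  also have "ball 0 1 \<inter> sgn -` T -` A = T -` (ball 0 1 \<inter> sgn -` A)"
    by (auto simp: nT sT)
  also have "emeasure lborel (T -` (ball 0 1 \<inter> sgn -` A)) = emeasure lborel (ball 0 1 \<inter> sgn -` A)"
    using A measurable_sets_borel[OF borel_measurable_sgn_euclidean A(1)]
    by (intro emeasure_lborel_orthogonal_vimage[OF T]) auto
  also have "\<dots> / emeasure lborel (ball (0::'b) 1) = emeasure sphere_measure A"
    by (rule emeasure_sphere_measure[OF A, symmetric])
  finally show "emeasure (distr sphere_measure sphere_measure T) A = emeasure sphere_measure A" .
qed simp


subsection \<open>Existence of the enumeration\<close>

lemma decreasing_enumeration_exists:
  fixes w :: "'c \<Rightarrow> real"
  assumes fin: "\<And>e. e > 0 \<Longrightarrow> finite {C \<in> F. e \<le> w C}" and pos: "\<And>C. C \<in> F \<Longrightarrow> w C > 0"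
  shows "\<exists>N c. decreasing_enumeration w F N c"
proof -
  have "F \<subseteq> (\<Union>n::nat. {C \<in> F. 1 / real (Suc n) \<le> w C})"
  proof
    fix C assume C: "C \<in> F"
    obtain n :: nat where "1 / w C < n" using reals_Archimedean2 by blast
    then have "1 / real (Suc n) \<le> w C" using pos[OF C] by (simp add: field_simps)
    with C have "C \<in> {C \<in> F. 1 / real (Suc n) \<le> w C}" by simp
    then show "C \<in> (\<Union>n::nat. {C \<in> F. 1 / real (Suc n) \<le> w C})" by (rule UN_I[OF UNIV_I])
  qed
  moreover have "countable (\<Union>n::nat. {C \<in> F. 1 / real (Suc n) \<le> w C})"
    by (intro countable_UN countable_finite[OF fin]) auto
  ultimately have "countable F" by (rule countable_subset)
  then obtain g :: "'c \<Rightarrow> nat" where g: "inj_on g F" by (auto simp: countable_def)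
  define lt where "lt C D \<longleftrightarrow> w C > w D \<or> w C = w D \<and> g C < g D" for C D
  define P where "P C = {D \<in> F. lt D C}" for C
  have irrefl: "\<not> lt C C" for C by (auto simp: lt_def)
  have trans: "lt C D \<Longrightarrow> lt D E \<Longrightarrow> lt C E" for C D E by (auto simp: lt_def)
  have total: "lt C D \<or> C = D \<or> lt D C" if "C \<in> F" "D \<in> F" for C D
    using that inj_onD[OF g, of C D] by (cases "g C = g D") (auto simp: lt_def)
  have finP: "finite (P C)" if "C \<in> F" for C
    by (rule finite_subset[OF _ fin[OF pos[OF that]]]) (auto simp: P_def lt_def)
  define rank where "rank C = card (P C)" for C
  have mono: "rank C < rank D" if "C \<in> F" "D \<in> F" "lt C D" for C D
    unfolding rank_def
  proof (rule psubset_card_mono[OF finP[OF \<open>D \<in> F\<close>]])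
    show "P C \<subset> P D"
      using that irrefl[of C] by (auto simp: P_def intro: trans)
  qed
  have inj: "inj_on rank F"
    by (rule inj_onI) (metis mono total less_irrefl)
  have down: "k \<in> rank ` F" if "C \<in> F" "k \<le> rank C" for C k
  proof -
    let ?Q = "insert C (P C)"
    have Q: "?Q \<subseteq> F" "finite ?Q" "C \<notin> P C"
      using that finP irrefl by (auto simp: P_def)
    have "rank ` ?Q \<subseteq> {..rank C}"
      using mono \<open>C \<in> F\<close> by (auto simp: P_def less_imp_le)
    moreover have "card (rank ` ?Q) = card ?Q"
      by (rule card_image[OF inj_on_subset[OF inj Q(1)]])
    then have "card (rank ` ?Q) = card {..rank C}"
      using Q(2,3) by (simp add: rank_def del: image_insert)
    ultimately have "rank ` ?Q = {..rank C}" by (intro card_subset_eq) auto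
    then show ?thesis using that Q by blast
  qed
  define N where "N = (if finite F then enat (card F) else \<infinity>)"
  have img: "rank ` F = {k. enat k < N}"
  proof (cases "finite F")
    case True
    have "rank ` F \<subseteq> {..<card F}"
      unfolding rank_def using True irrefl
      by (auto intro!: psubset_card_mono simp: P_def)
    moreover have "card (rank ` F) = card F" using inj by (rule card_image)
    ultimately have "rank ` F = {..<card F}" by (intro card_subset_eq) auto
    then show ?thesis using True by (auto simp: N_def)
  next
    case False
    then have "infinite (rank ` F)" using inj by (simp add: finite_image_iff)
    then have "\<exists>C\<in>F. k \<le> rank C" for k
      unfolding infinite_nat_iff_unbounded_le by auto
    then show ?thesis using down False by (auto simp: N_def)
  qed
  have bij: "bij_betw rank F {k. enat k < N}"
    using inj img by (simp add: bij_betw_def)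
  define c where "c = inv_into F rank"
  have "bij_betw c {k. enat k < N} F"
    unfolding c_def by (rule bij_betw_inv_into[OF bij])
  moreover have "w (c l) \<le> w (c k)" if "k \<le> l" "enat l < N" for k l
  proof (rule ccontr)
    have "enat k < N" using that by (meson enat_ord_simps(1) order_le_less_trans)
    then have *: "c k \<in> F" "c l \<in> F" "rank (c k) = k" "rank (c l) = l"
      using that img unfolding c_def by (auto intro!: inv_into_into f_inv_into_f)
    assume "\<not> w (c l) \<le> w (c k)"
    then have "lt (c l) (c k)" by (simp add: lt_def)
    with mono[of "c l" "c k"] * that show False by simp
  qed
  ultimately show ?thesis unfolding decreasing_enumeration_def by blast
qed

lemma finite_wide_slab_components:
  assumes path: "generalized_path X \<gamma>" and "\<mu> > 0" and "e > 0"
  shows "finite {C \<in> slab_components X \<gamma> x u \<mu>. e \<le> width u (\<gamma> ` C)}"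
proof -
  define h where "h = (\<lambda>p. \<gamma> p \<bullet> u)"
  have X: "compact X" "locally connected X" and cont: "continuous_on X h"
    using path unfolding generalized_path_def h_def by (auto intro!: continuous_intros)
  define K where "K j = {p \<in> X. \<gamma> p \<in> slab x u \<mu> j}" for j
  have K: "K j = {p \<in> X. h p \<in> {\<mu> * (j + x) .. \<mu> * (j + 1 + x)}}" for j
    by (auto simp: K_def slab_def h_def)
  define W where "W j = {C \<in> components (K j). e \<le> diameter (h ` C)}" for j
  have wid: "width u (\<gamma> ` C) = diameter (h ` C)" for C
    by (simp add: width_def h_def image_image)
  have finW: "finite (W j)" for j
  proof -
    define a b where "a = \<mu> * (j + x)" and "b = \<mu> * (j + 1 + x)"
    define G where "G t = {C \<in> components (K j). \<exists>p \<in> C. h p = t}" for t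
    have finG: "finite (G t)" if t: "a < t" "t < b" for t
    proof -
      define U where "U = {p \<in> X. h p \<in> {a<..<b}}"
      define Z where "Z = {p \<in> X. h p = t}"
      have "openin (top_of_set X) U"
        unfolding U_def using continuous_openin_preimage_gen[OF cont open_greaterThanLessThan, of a b]
        by (simp add: vimage_def Int_def)
      then have op: "openin (top_of_set X) D" if "D \<in> components U" for D
        using X(2) that locally_connected_open_component by blast
      have "closedin (top_of_set X) Z"
        unfolding Z_def using continuous_closedin_preimage_constant[OF cont] by simp
      then have "compact Z" using X(1) closedin_compact by blast
      moreover have "Z \<subseteq> \<Union>(components U)" using t by (auto simp: Z_def U_def)
      moreover have "Z \<subseteq> X" by (auto simp: Z_def)
      ultimately obtain \<D> where \<D>: "\<D> \<subseteq> components U" "finite \<D>" "Z \<subseteq> \<Union>\<D>"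
      proof -
        have "\<forall>D\<in>components U. \<exists>T. open T \<and> D = X \<inter> T"
          using op by (simp add: openin_open)
        then obtain T where T: "\<And>D. D \<in> components U \<Longrightarrow> open (T D) \<and> D = X \<inter> T D"
          by metis
        have "Z \<subseteq> (\<Union>D\<in>components U. T D)"
          using \<open>Z \<subseteq> \<Union>(components U)\<close> T by blast
        with \<open>compact Z\<close> T obtain \<D> where "\<D> \<subseteq> components U" "finite \<D>" "Z \<subseteq> (\<Union>D\<in>\<D>. T D)"
          using compactE_image[of Z "components U" T] by metis
        moreover from this have "Z \<subseteq> \<Union>\<D>"
          using T \<open>Z \<subseteq> X\<close> by blast
        ultimately show thesis using that by blast
      qed
      have sub: "U \<subseteq> K j" by (auto simp: U_def K a_def b_def)
      have "\<exists>D\<in>\<D>. D \<subseteq> C \<and> D \<noteq> {}" if "C \<in> G t" for C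
      proof -
        obtain p where p: "C \<in> components (K j)" "p \<in> C" "h p = t" using \<open>C \<in> G t\<close> by (auto simp: G_def)
        then have "p \<in> Z" using in_components_subset[of C "K j"] by (auto simp: Z_def K_def)
        then obtain D where D: "D \<in> \<D>" "p \<in> D" using \<D> by blast
        then have "D \<in> components U" using \<D> by blast
        then have "connected D" "D \<subseteq> K j"
          using sub in_components_connected in_components_subset by blast+
        then have "D \<subseteq> C" using components_maximal[OF p(1)] p D by blast
        then show ?thesis using D by blast
      qed
      then obtain f where f: "\<And>C. C \<in> G t \<Longrightarrow> f C \<in> \<D> \<and> f C \<subseteq> C \<and> f C \<noteq> {}" by metis
      have "inj_on f (G t)"
      proof (rule inj_onI)
        fix C D assume *: "C \<in> G t" "D \<in> G t" "f C = f D"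
        then have "C \<in> components (K j)" "D \<in> components (K j)" "C \<inter> D \<noteq> {}"
          using f[of C] f[of D] by (auto simp: G_def)
        then show "C = D" using components_nonoverlap by blast
      qed
      moreover have "f ` G t \<subseteq> \<D>" using f by blast
      ultimately show ?thesis using \<D>(2) by (metis finite_imageD finite_subset)
    qed
    define M where "M = {m::int. a < m * (e / 3) \<and> m * (e / 3) < b}"
    have "M \<subseteq> {\<lfloor>a / (e/3)\<rfloor> .. \<lceil>b / (e/3)\<rceil>}"
    proof
      fix m assume "m \<in> M"
      then have "a / (e/3) < m" "m < b / (e/3)"
        using \<open>e > 0\<close> by (auto simp: M_def field_simps)
      then show "m \<in> {\<lfloor>a / (e/3)\<rfloor> .. \<lceil>b / (e/3)\<rceil>}" by (auto simp: floor_le_iff le_ceiling_iff)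
    qed
    then have "finite M" by (rule finite_subset) simp
    moreover have "W j \<subseteq> (\<Union>m\<in>M. G (m * (e / 3)))"
    proof
      fix C assume "C \<in> W j"
      then have C: "C \<in> components (K j)" "e \<le> diameter (h ` C)" by (auto simp: W_def)
      have CK: "C \<subseteq> K j" "C \<noteq> {}" "connected C"
        using C(1) in_components_subset in_components_nonempty in_components_connected by blast+
      have "\<exists>p\<in>C. \<exists>q\<in>C. h q - h p > 2 * e / 3"
      proof (rule ccontr)
        assume "\<not> ?thesis"
        then have *: "h q - h p \<le> 2 * e / 3" if "p \<in> C" "q \<in> C" for p q
          using that not_less by blast
        have "diameter (h ` C) \<le> 2 * e / 3"
        proof (rule diameter_le)
          fix s t assume "s \<in> h ` C" "t \<in> h ` C"
          then obtain p q where "p \<in> C" "q \<in> C" "s = h p" "t = h q" by blast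
          then show "norm (s - t) \<le> 2 * e / 3"
            using *[of p q] *[of q p] unfolding real_norm_def by linarith
        qed (use CK in auto)
        then show False using C \<open>e > 0\<close> by simp
      qed
      then obtain p q where pq: "p \<in> C" "q \<in> C" "h q - h p > 2 * e / 3" by blast
      define m where "m = \<lfloor>h p / (e / 3)\<rfloor> + 1"
      have m: "h p < m * (e / 3)" "m * (e / 3) \<le> h p + e / 3"
      proof -
        have "h p / (e / 3) < m" "m \<le> h p / (e / 3) + 1" unfolding m_def by linarith+
        then show "h p < m * (e / 3)" "m * (e / 3) \<le> h p + e / 3"
          using \<open>e > 0\<close> by (simp_all add: field_simps)
      qed
      have "continuous_on C h" using CK(1) by (intro continuous_on_subset[OF cont]) (auto simp: K_def)
      then have "connected (h ` C)" using CK(3) by (rule connected_continuous_image)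
      then have "m * (e / 3) \<in> h ` C"
        by (rule connectedD_interval[of _ "h p" "h q"]) (use pq m \<open>e > 0\<close> in auto)
      moreover have "a \<le> h p" "h q \<le> b" using pq CK(1) by (auto simp: K a_def b_def)
      then have "m \<in> M" using m pq(3) \<open>e > 0\<close> unfolding M_def by auto
      ultimately have "m \<in> M" "C \<in> G (m * (e / 3))" using C(1) by (auto simp only: G_def)
      then show "C \<in> (\<Union>m\<in>M. G (m * (e / 3)))" by (rule UN_I)
    qed
    moreover have "finite (G (m * (e / 3)))" if "m \<in> M" for m
      using that by (intro finG) (auto simp: M_def)
    ultimately show ?thesis by (meson finite_UN_I finite_subset)
  qed
  have "bounded (h ` X)"
    using X(1) cont compact_continuous_image compact_imp_bounded by blast
  then obtain B where B: "\<And>p. p \<in> X \<Longrightarrow> \<bar>h p\<bar> \<le> B" by (auto simp: bounded_iff)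
  define J where "J = {\<lfloor>- B / \<mu> - x - 1\<rfloor> .. \<lceil>B / \<mu> - x\<rceil>}"
  have "{C \<in> slab_components X \<gamma> x u \<mu>. e \<le> width u (\<gamma> ` C)} \<subseteq> (\<Union>j\<in>J. W j)"
  proof
    fix C assume "C \<in> {C \<in> slab_components X \<gamma> x u \<mu>. e \<le> width u (\<gamma> ` C)}"
    then obtain j where j: "C \<in> components (K j)" "e \<le> diameter (h ` C)"
      by (auto simp: slab_components_def K_def wid)
    then obtain p where "p \<in> K j" using in_components_nonempty in_components_subset by blast
    then have "\<bar>h p\<bar> \<le> B" "\<mu> * (j + x) \<le> h p" "h p \<le> \<mu> * (j + 1 + x)"
      using B by (auto simp: K)
    then have "\<mu> * (j + x) \<le> B" "- B \<le> \<mu> * (j + 1 + x)" by linarith+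
    then have "j + x \<le> B / \<mu>" "- B / \<mu> \<le> j + 1 + x"
      using \<open>\<mu> > 0\<close> by (simp_all add: field_simps)
    then have "j \<in> J" unfolding J_def atLeastAtMost_iff by linarith
    then show "C \<in> (\<Union>j\<in>J. W j)" using j by (auto simp: W_def)
  qed
  then show ?thesis
    by (rule finite_subset) (use finW in \<open>auto simp: J_def\<close>)
qed

corollary slab_components_enumerable:
  assumes "generalized_path X \<gamma>" "\<mu> > 0"
  shows "\<exists>N c. decreasing_enumeration (\<lambda>C. width u (\<gamma> ` C)) (slab_components X \<gamma> x u \<mu>) N c"
  by (rule decreasing_enumeration_exists)
     (use finite_wide_slab_components[OF assms] in \<open>auto simp: slab_components_def\<close>)

end

theory Submission
  imports Defs
begin

text \<open>The components of the segment's slab preimages inject into those of \<open>\<gamma>\<close> without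
  decreasing any width: a connected set whose projection covers \<open>[s, t]\<close> has a component of the
  preimage of \<open>[s, t]\<close> that crosses from level \<open>s\<close> to level \<open>t\<close>, by the coincidence of
  components and quasi-components in compact spaces. By the rearrangement inequality the weighted
  sum is the largest over all enumerations, so the integrands compare pointwise. One unmatched
  component of width \<open>\<eta>\<close>, listed after the at most \<open>N\<close> matched ones, gains at least
  \<open>2\<^sup>-\<^sup>N \<eta>\<close>. If \<open>w \<in> \<gamma>(X)\<close> is off the segment, take \<open>u\<close> near a separating direction and \<open>\<mu>\<close>
  small: some slab lies between the segment and \<open>w\<close>, and \<open>\<gamma>\<close> crosses it. If \<open>\<gamma>(X)\<close> is the
  segment and the fibre of \<open>w\<close> is disconnected, a thin slab with \<open>w\<close> well inside has two
  components meeting the fibre, each reaching the boundary of the slab.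

  The integrand is not known to be measurable, so its integral is a lower integral;
  the strict inequality relies on superadditivity of the latter.\<close>

section \<open>Lower integrals, and open sets of the sphere\<close>

text \<open>A simple function below \<open>f\<close> is measurable, so its integral and that of
  \<open>g\<close> add up; taking the supremum over these functions gives the claim.\<close>

lemma nn_integral_superadd:
  assumes [measurable]: "g \<in> borel_measurable M"
  shows "(\<integral>\<^sup>+x. f x \<partial>M) + (\<integral>\<^sup>+x. g x \<partial>M) \<le> (\<integral>\<^sup>+x. f x + g x \<partial>M)"
proof -
  let ?S = "{s. simple_function M s \<and> s \<le> f}"
  have "(\<integral>\<^sup>+x. f x \<partial>M) + (\<integral>\<^sup>+x. g x \<partial>M) = (SUP s\<in>?S. integral\<^sup>S M s + (\<integral>\<^sup>+x. g x \<partial>M))"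
    unfolding nn_integral_def[of M f]
    by (rule ennreal_SUP_add_left[symmetric]) (auto intro!: exI[of _ "\<lambda>_. 0"] simp: le_fun_def)
  also have "\<dots> \<le> (\<integral>\<^sup>+x. f x + g x \<partial>M)"
  proof (rule SUP_least)
    fix s assume s: "s \<in> ?S"
    then have [measurable]: "s \<in> borel_measurable M" by (auto intro: borel_measurable_simple_function)
    have "integral\<^sup>S M s + (\<integral>\<^sup>+x. g x \<partial>M) = (\<integral>\<^sup>+x. s x + g x \<partial>M)"
      using s by (simp add: nn_integral_eq_simple_integral nn_integral_add)
    also have "\<dots> \<le> (\<integral>\<^sup>+x. f x + g x \<partial>M)"
      using s by (intro nn_integral_mono add_right_mono) (auto simp: le_fun_def)
    finally show "integral\<^sup>S M s + (\<integral>\<^sup>+x. g x \<partial>M) \<le> (\<integral>\<^sup>+x. f x + g x \<partial>M)" .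
  qed
  finally show ?thesis .
qed

text \<open>Radial projection pulls \<open>S\<close> back to an open cone in the punctured ball. The
  cone contains \<open>u\<close> scaled to norm 1/2, and nonempty open sets are not null.\<close>

lemma emeasure_sphere_measure_pos:
  fixes S :: "'b::euclidean_space set"
  assumes "open S" "u \<in> S" "norm u = 1"
  shows "emeasure sphere_measure (sphere 0 1 \<inter> S) > 0"
proof -
  have "continuous_on (- {0::'b}) sgn"
    unfolding sgn_div_norm by (intro continuous_intros) auto
  then have "open (sgn -` S \<inter> - {0::'b})"
    using assms(1) continuous_on_open_vimage[of "- {0::'b}" sgn] by auto
  then have op: "open (ball 0 1 \<inter> (sgn -` S \<inter> - {0::'b}))" by auto
  have "(1/2) *\<^sub>R u \<in> ball 0 1 \<inter> (sgn -` S \<inter> - {0})"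
    using assms by (auto simp: sgn_div_norm)
  then have "\<not> negligible (ball 0 1 \<inter> (sgn -` S \<inter> - {0::'b}))"
    using op open_not_negligible by blast
  then have "emeasure lborel (ball 0 1 \<inter> (sgn -` S \<inter> - {0::'b})) \<noteq> 0"
    using op by (simp add: negligible_iff_emeasure0)
  moreover have "ball 0 1 \<inter> sgn -` (sphere 0 1 \<inter> S) = ball 0 1 \<inter> (sgn -` S \<inter> - {0::'b})"
    by (auto simp: norm_sgn)
  moreover have "emeasure lborel (ball (0::'b) 1) \<noteq> \<infinity>"
    by (simp add: emeasure_ball)
  ultimately show ?thesis
    using assms(1) by (subst emeasure_sphere_measure) (auto simp: ennreal_zero_less_divide less_top zero_less_iff_neq_zero)
qed

section \<open>Rearrangement of weighted sums\<close>

text \<open>Induction that removes the largest index: among \<open>n + 1\<close> distinct naturals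
  it is at least \<open>n\<close>, so its value is at most \<open>a n\<close>.\<close>

lemma sum_le_sum_lessThan_card:
  fixes a :: "nat \<Rightarrow> real"
  assumes "antimono a" "finite S"
  shows "sum a S \<le> sum a {..<card S}"
  using assms(2)
proof (induction "card S" arbitrary: S)
  case (Suc n)
  then have "S \<noteq> {}" by auto
  then have ne: "Max S \<in> S" using Suc(3) by simp
  then have card: "card (S - {Max S}) = n" using Suc by simp
  have "S \<subseteq> {..Max S}" using Suc by auto
  then have "card S \<le> Suc (Max S)" using card_mono[of "{..Max S}" S] by simp
  then have "n \<le> Max S" using Suc by simp
  then have "a (Max S) \<le> a n" using assms(1) by (auto dest: antimonoD)
  moreover have "sum a (S - {Max S}) \<le> sum a {..<n}"
    using Suc(1)[of "S - {Max S}"] Suc card by simp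
  moreover have "sum a S = a (Max S) + sum a (S - {Max S})"
    using Suc ne by (simp add: sum.remove)
  ultimately show ?case by (simp add: Suc(2)[symmetric])
qed simp

lemma weighted_sum_mono_partial_sums:
  fixes v d :: "nat \<Rightarrow> real"
  assumes "antimono v" "\<And>k. 0 \<le> v k" "\<And>k. k \<le> m \<Longrightarrow> 0 \<le> sum d {..<k}"
  shows "0 \<le> (\<Sum>i<m. v i * d i)"
proof -
  \<comment> \<open>Summation by parts; keeping the boundary term is what makes the induction go
    through.\<close>
  have "v m * sum d {..<m} \<le> (\<Sum>i<m. v i * d i)"
    using assms(3)
  proof (induction m)
    case (Suc m)
    have "v (Suc m) * sum d {..<Suc m} \<le> v m * sum d {..<Suc m}"
      using Suc(2)[of "Suc m"] assms(1) by (intro mult_right_mono) (auto simp: antimono_iff_le_Suc)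
    also have "\<dots> \<le> (\<Sum>i<Suc m. v i * d i)"
      using Suc by (simp add: algebra_simps)
    finally show ?case .
  qed simp
  then show ?thesis using assms(2,3)[of m] by (smt (verit) mult_nonneg_nonneg order_refl)
qed

text \<open>Distinct indices are selected, so each partial sum of the selected values is bounded by
  that of the first ones; summation by parts carries this over to the weighted sums.\<close>

lemma rearrangement_injection:
  fixes v a :: "nat \<Rightarrow> real"
  assumes "antimono v" "\<And>k. 0 \<le> v k" "antimono a" "inj_on \<pi> {..<m}"
  shows "(\<Sum>k<m. v k * a (\<pi> k)) \<le> (\<Sum>k<m. v k * a k)"
proof -
  have "0 \<le> (\<Sum>k<m. v k * (a k - a (\<pi> k)))"
  proof (rule weighted_sum_mono_partial_sums[OF assms(1,2)])
    fix k assume "k \<le> m"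
    then have inj: "inj_on \<pi> {..<k}" using assms(4) by (auto intro: inj_on_subset)
    then have "(\<Sum>i<k. a (\<pi> i)) = sum a (\<pi> ` {..<k})" by (simp add: sum.reindex)
    also have "\<dots> \<le> sum a {..<k}"
      using sum_le_sum_lessThan_card[OF assms(3), of "\<pi> ` {..<k}"] inj by (simp add: card_image)
    finally show "0 \<le> (\<Sum>i<k. a i - a (\<pi> i))" by (simp add: sum_subtractf)
  qed
  then show ?thesis by (simp add: sum_subtractf right_diff_distrib)
qed

section \<open>Connected sets crossing a band of levels\<close>

text \<open>The cut-wire-fence theorem for the compact space \<open>K\<close>, with the two clopen
  pieces returned as compact sets.\<close>

lemma compact_separation:
  fixes K :: "'a::metric_space set"
  assumes "compact K" "closed A" "closed B" "A \<subseteq> K" "B \<subseteq> K"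
    and "\<And>C. connected C \<Longrightarrow> C \<subseteq> K \<Longrightarrow> C \<inter> A = {} \<or> C \<inter> B = {}"
  obtains U V where "compact U" "compact V" "U \<union> V = K" "U \<inter> V = {}" "A \<subseteq> U" "B \<subseteq> V"
proof -
  have "separated_between (top_of_set K) A B"
    using assms
    by (intro cut_wire_fence_theorem)
       (auto simp: compact_space_subtopology Hausdorff_space_subtopology disjnt_def
         connectedin_subtopology closedin_closed_eq compact_imp_closed Int_absorb2 compactin_euclidean_iff
         intro: closed_subset)
  then obtain U V where UV: "openin (top_of_set K) U" "openin (top_of_set K) V"
      "U \<union> V = K" "disjnt U V" "A \<subseteq> U" "B \<subseteq> V"
    by (auto simp: separated_between_def)
  then have "U = K - V" "V = K - U" by (auto simp: disjnt_def)
  then have "closedin (top_of_set K) U" "closedin (top_of_set K) V"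
    using UV by (metis closedin_diff closedin_subtopology_refl subset_UNIV topspace_euclidean)+
  then have "compact U" "compact V" using assms(1) closedin_compact by blast+
  then show thesis using that UV by (auto simp: disjnt_def)
qed

lemma connected_subset_of_component:
  assumes "connected C" "C \<subseteq> K" "C \<noteq> {}"
  obtains D where "D \<in> components K" "C \<subseteq> D"
  using assms exists_component_superset[of C K] by blast

lemma compact_level_sets:
  fixes h :: "'a::metric_space \<Rightarrow> real"
  assumes "compact X" "continuous_on X h" "closed T"
  shows "compact {p \<in> X. h p \<in> T}"
proof -
  have "closedin (top_of_set X) (X \<inter> h -` T)"
    by (rule continuous_closedin_preimage[OF assms(2,3)])
  then have "compact (X \<inter> h -` T)" using assms(1) closedin_compact by blast
  then show ?thesis by (simp add: vimage_def Int_def)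
qed

text \<open>If no connected set joined level \<open>s\<close> to level \<open>t\<close> within
  \<open>{s..t}\<close>, a fence would split that band. Adding the points at or below
  \<open>s\<close> to one part and those at or above \<open>t\<close> to the other would then
  disconnect \<open>X\<close>. The joining set lies in a component for the wider band
  \<open>{l..r}\<close>.\<close>

lemma crossing_component:
  fixes h :: "'a::metric_space \<Rightarrow> real"
  assumes X: "compact X" "connected X" "continuous_on X h"
    and pq: "p \<in> X" "q \<in> X" "h p \<le> s" "t \<le> h q" and st: "l \<le> s" "s < t" "t \<le> r"
  obtains C a b where "C \<in> components {p \<in> X. h p \<in> {l..r}}" "a \<in> C" "b \<in> C" "h a = s" "h b = t"
proof -
  let ?L = "\<lambda>T. {p \<in> X. h p \<in> T}"
  have cl: "compact (?L T)" if "closed T" for T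
    by (rule compact_level_sets[OF X(1,3) that])
  have "\<exists>C. connected C \<and> C \<subseteq> ?L {s..t} \<and> C \<inter> ?L {s} \<noteq> {} \<and> C \<inter> ?L {t} \<noteq> {}"
  proof (rule ccontr)
    assume neg: "\<not> ?thesis"
    obtain U V where UV: "compact U" "compact V" "U \<union> V = ?L {s..t}" "U \<inter> V = {}"
        "?L {s} \<subseteq> U" "?L {t} \<subseteq> V"
    proof (rule compact_separation[OF cl compact_imp_closed[OF cl] compact_imp_closed[OF cl]])
      show "closed {s..t}" "closed {s}" "closed {t}" by auto
      show "?L {s} \<subseteq> ?L {s..t}" "?L {t} \<subseteq> ?L {s..t}" using st by auto
      show "C \<inter> ?L {s} = {} \<or> C \<inter> ?L {t} = {}" if "connected C" "C \<subseteq> ?L {s..t}" for C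
        using neg that by blast
    qed
    have "closed (?L {..s})" "closed (?L {t..})"
      by (rule compact_imp_closed[OF cl], simp)+
    moreover have "closed U" "closed V"
      using UV(1,2) by (auto intro: compact_imp_closed)
    ultimately have "closed (?L {..s} \<union> U)" "closed (?L {t..} \<union> V)"
      by - (rule closed_Un | assumption)+
    \<comment> \<open>A point of \<open>U\<close> at level \<open>t\<close> would also lie in
      \<open>V\<close>, and a point of \<open>V\<close> at level \<open>s\<close> also in
      \<open>U\<close>.\<close>
    moreover have "(?L {..s} \<union> U) \<inter> (?L {t..} \<union> V) \<inter> X = {}"
    proof -
      have "h y \<in> {s..t}" "h y = s \<Longrightarrow> y \<in> U" "h y = t \<Longrightarrow> y \<in> V" if "y \<in> U \<union> V" for y
        using that UV(3,5,6) by blast+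
      note * = this
      then have "y \<notin> ?L {t..}" if "y \<in> U" for y
        using that UV(4) by (metis (lifting) IntI UnI1 antisym atLeastAtMost_iff atLeast_iff empty_iff mem_Collect_eq)
      moreover have "y \<notin> ?L {..s}" if "y \<in> V" for y
        using that UV(4) * by (metis (lifting) IntI UnI2 antisym atLeastAtMost_iff atMost_iff empty_iff mem_Collect_eq)
      moreover have "?L {..s} \<inter> ?L {t..} = {}" using st by auto
      ultimately show ?thesis using UV(4) by blast
    qed
    moreover have "X \<subseteq> (?L {..s} \<union> U) \<union> (?L {t..} \<union> V)"
    proof
      fix y assume y: "y \<in> X"
      have "y \<in> U \<union> V" if "h y \<in> {s..t}" using that y UV(3) by blast
      moreover have "h y \<in> {..s} \<or> h y \<in> {s..t} \<or> h y \<in> {t..}" by auto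
      ultimately show "y \<in> (?L {..s} \<union> U) \<union> (?L {t..} \<union> V)" using y by blast
    qed
    ultimately have "(?L {..s} \<union> U) \<inter> X = {} \<or> (?L {t..} \<union> V) \<inter> X = {}"
      using connected_closedD[OF X(2)] by blast
    moreover have "p \<in> ?L {..s}" "q \<in> ?L {t..}" using pq by auto
    ultimately show False using pq(1,2) by blast
  qed
  then obtain C where C: "connected C" "C \<subseteq> ?L {s..t}" "C \<inter> ?L {s} \<noteq> {}" "C \<inter> ?L {t} \<noteq> {}"
    by blast
  have "?L {s..t} \<subseteq> ?L {l..r}" using st by auto
  with C(2) have "C \<subseteq> ?L {l..r}" by (rule subset_trans)
  moreover have "C \<noteq> {}" using C(3) by blast
  ultimately obtain D where D: "D \<in> components (?L {l..r})" "C \<subseteq> D"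
    using connected_subset_of_component[OF C(1)] by blast
  obtain a b where "a \<in> C" "h a = s" "b \<in> C" "h b = t" using C(3,4) by blast
  then show thesis using that D by blast
qed

text \<open>Boundary bumping: a component missing both end levels could be enclosed in a closed
  piece \<open>U\<close> away from them, and the rest of \<open>X\<close> would be closed too. This
  contradicts connectedness, as \<open>q\<close> lies in the rest.\<close>

lemma component_reaches_boundary:
  fixes h :: "'a::metric_space \<Rightarrow> real"
  assumes X: "compact X" "connected X" "continuous_on X h"
    and q: "q \<in> X" "h q \<notin> {l..r}" and C: "C \<in> components {p \<in> X. h p \<in> {l..r}}"
  obtains p where "p \<in> C" "h p = l \<or> h p = r"
proof -
  let ?L = "\<lambda>T. {p \<in> X. h p \<in> T}"
  have cl: "compact (?L T)" if "closed T" for T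
    by (rule compact_level_sets[OF X(1,3) that])
  have Csub: "C \<subseteq> ?L {l..r}" "C \<noteq> {}"
    using C in_components_subset in_components_nonempty by blast+
  have "C \<inter> ?L {l, r} \<noteq> {}"
  proof
    assume neg: "C \<inter> ?L {l, r} = {}"
    have "closedin (top_of_set (?L {l..r})) C" using C by (rule closedin_component)
    then have "compact C" using cl closedin_compact by blast
    obtain c where c: "c \<in> C" using Csub(2) by blast
    \<comment> \<open>Intersecting with \<open>?L {l..r}\<close> makes the end levels a subset of
      the band without first comparing \<open>l\<close> and \<open>r\<close>.\<close>
    obtain U V where UV: "compact U" "compact V" "U \<union> V = ?L {l..r}" "U \<inter> V = {}"
        "C \<subseteq> U" "?L {l, r} \<inter> ?L {l..r} \<subseteq> V"
    proof (rule compact_separation[OF cl compact_imp_closed[OF \<open>compact C\<close>]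
          closed_Int[OF compact_imp_closed[OF cl] compact_imp_closed[OF cl]]])
      show "D \<inter> C = {} \<or> D \<inter> (?L {l, r} \<inter> ?L {l..r}) = {}"
        if "connected D" "D \<subseteq> ?L {l..r}" for D
        using components_maximal[OF C that] neg by blast
    qed (use Csub in auto)
    have "closed (?L {..l})" "closed (?L {r..})"
      by (rule compact_imp_closed[OF cl], simp)+
    moreover have "closed U" "closed V"
      using UV(1,2) by (auto intro: compact_imp_closed)
    ultimately have "closed U" "closed (V \<union> ?L {..l} \<union> ?L {r..})"
      by - (rule closed_Un | assumption)+
    moreover have "U \<inter> (V \<union> ?L {..l} \<union> ?L {r..}) \<inter> X = {}"
    proof -
      have "h y \<in> {l<..<r}" if "y \<in> U" for y
      proof -
        have "y \<in> ?L {l..r}" "y \<notin> V" using that UV(3,4) by blast+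
        then have "y \<notin> ?L {l, r}" using UV(6) by blast
        then show ?thesis using \<open>y \<in> ?L {l..r}\<close> by auto
      qed
      then have "U \<inter> (?L {..l} \<union> ?L {r..}) = {}" by fastforce
      then show ?thesis using UV(4) by blast
    qed
    moreover have "X \<subseteq> U \<union> (V \<union> ?L {..l} \<union> ?L {r..})"
    proof
      fix y assume y: "y \<in> X"
      have "y \<in> U \<union> V" if "h y \<in> {l..r}" using that y UV(3) by blast
      moreover have "h y \<in> {..l} \<or> h y \<in> {l..r} \<or> h y \<in> {r..}" by auto
      ultimately show "y \<in> U \<union> (V \<union> ?L {..l} \<union> ?L {r..})" using y by blast
    qed
    ultimately have "U \<inter> X = {} \<or> (V \<union> ?L {..l} \<union> ?L {r..}) \<inter> X = {}"
      using connected_closedD[OF X(2)] by blast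
    moreover have "c \<in> U \<inter> X" using c UV(5) Csub(1) by blast
    moreover have "q \<in> ?L {..l} \<union> ?L {r..}" using q by auto
    ultimately show False using q(1) by blast
  qed
  then show thesis using that by blast
qed

section \<open>Slabs, widths and slab indices\<close>

lemma slab_preimage_eq:
  "{p \<in> X. \<gamma> p \<in> slab x u \<mu> j} = {p \<in> X. \<gamma> p \<bullet> u \<in> {\<mu> * (of_int j + x)..\<mu> * (of_int j + 1 + x)}}"
  by (auto simp: slab_def)

text \<open>Compactness of \<open>X\<close> supplies the boundedness under which
  \<open>diameter\<close> bounds distances.\<close>

lemma abs_inner_diff_le_width:
  fixes \<gamma> :: "'a::metric_space \<Rightarrow> 'b::euclidean_space"
  assumes "generalized_path X \<gamma>" "C \<subseteq> X" "p \<in> C" "q \<in> C"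
  shows "\<bar>\<gamma> p \<bullet> u - \<gamma> q \<bullet> u\<bar> \<le> width u (\<gamma> ` C)"
proof -
  have "compact ((\<lambda>p. \<gamma> p \<bullet> u) ` X)"
    using assms(1) by (auto simp: generalized_path_def intro!: compact_continuous_image continuous_intros)
  then have "bounded ((\<lambda>p. \<gamma> p \<bullet> u) ` C)"
    using assms(2) by (meson bounded_subset compact_imp_bounded image_mono)
  from diameter_bounded_bound[OF this, of "\<gamma> p \<bullet> u" "\<gamma> q \<bullet> u"] assms(3,4)
  show ?thesis by (auto simp: width_def image_image dist_real_def)
qed

text \<open>The upper face of slab \<open>i\<close> is not above the lower face of slab
  \<open>j\<close>, so common points all lie at one level.\<close>

lemma width_eq_0_if_two_slabs:
  assumes "\<And>z. z \<in> A \<Longrightarrow> z \<in> slab x u \<mu> i \<and> z \<in> slab x u \<mu> j" "i < j" "\<mu> > 0"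
  shows "width u A = 0"
proof -
  have "z \<bullet> u = \<mu> * (of_int i + 1 + x)" if "z \<in> A" for z
  proof (rule antisym)
    have "\<mu> * (of_int i + 1 + x) \<le> \<mu> * (of_int j + x)"
      using assms(2,3) by (intro mult_left_mono) auto
    then show "\<mu> * (of_int i + 1 + x) \<le> z \<bullet> u"
      using assms(1)[OF that] by (auto simp: slab_def)
  qed (use assms(1)[OF that] in \<open>auto simp: slab_def\<close>)
  then have "(\<lambda>z. z \<bullet> u) ` A \<subseteq> {\<mu> * (of_int i + 1 + x)}" by blast
  then have "(\<lambda>z. z \<bullet> u) ` A = {} \<or> (\<lambda>z. z \<bullet> u) ` A = {\<mu> * (of_int i + 1 + x)}"
    by (simp only: subset_singleton_iff)
  then show ?thesis unfolding width_def by (metis diameter_empty diameter_singleton)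
qed

text \<open>A component of positive width thus has a well-defined slab, from which the injectivity
  of the matching below is derived.\<close>

lemma slab_index_unique:
  assumes "C \<in> components {p \<in> X. \<gamma> p \<in> slab x u \<mu> i}" "C \<in> components {p \<in> X. \<gamma> p \<in> slab x u \<mu> j}"
    and "width u (\<gamma> ` C) > 0" "\<mu> > 0"
  shows "i = j"
proof -
  have "C \<subseteq> {p \<in> X. \<gamma> p \<in> slab x u \<mu> i}" "C \<subseteq> {p \<in> X. \<gamma> p \<in> slab x u \<mu> j}"
    using assms in_components_subset by blast+
  then have "\<And>z. z \<in> \<gamma> ` C \<Longrightarrow> z \<in> slab x u \<mu> i \<and> z \<in> slab x u \<mu> j" by blast
  then show ?thesis
    using width_eq_0_if_two_slabs[of "\<gamma> ` C" x u \<mu> i j] width_eq_0_if_two_slabs[of "\<gamma> ` C" x u \<mu> j i] assms(3,4)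
    by (metis less_irrefl linorder_neqE)
qed

section \<open>Components of the segment and their counterparts\<close>

lemma generalized_path_linepath: "generalized_path {0..1} (linepath z1 z2)"
  unfolding generalized_path_def
  by (auto intro!: convex_imp_locally_connected continuous_on_linepath)

lemma linepath_inner: "linepath z1 z2 t \<bullet> u = z1 \<bullet> u + t * ((z2 - z1) \<bullet> u)"
  by (simp add: linepath_def algebra_simps)

text \<open>The projection of the segment is affine in the parameter, so the preimage of a slab is
  convex and has at most one component.\<close>

lemma linepath_slab_component_eq:
  assumes "C \<in> components {t \<in> {0..1}. linepath z1 z2 t \<in> slab x u \<mu> j}"
  shows "C = {t \<in> {0..1}. linepath z1 z2 t \<in> slab x u \<mu> j}"
proof -
  let ?d = "(z2 - z1) \<bullet> u"
  have "{t \<in> {0..1}. linepath z1 z2 t \<in> slab x u \<mu> j} =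
      {0..1} \<inter> {t. ?d \<bullet> t \<ge> \<mu> * (of_int j + x) - z1 \<bullet> u} \<inter> {t. ?d \<bullet> t \<le> \<mu> * (of_int j + 1 + x) - z1 \<bullet> u}"
    by (auto simp: slab_def linepath_inner algebra_simps)
  then have "convex {t \<in> {0..1}. linepath z1 z2 t \<in> slab x u \<mu> j}"
    by (simp only: convex_Int convex_halfspace_le convex_halfspace_ge convex_real_interval)
  then have "components {t \<in> {0..1}. linepath z1 z2 t \<in> slab x u \<mu> j} \<subseteq>
      {{t \<in> {0..1}. linepath z1 z2 t \<in> slab x u \<mu> j}}"
    by (simp only: convex_connected connected_eq_components_subset_sing[symmetric])
  then show ?thesis using assms by blast
qed

text \<open>The projection of \<open>C\<close> attains its extremes, which lie in the slab and
  between the projections of the endpoints. As \<open>\<gamma>\<close> takes both endpoints as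
  values, one of its components crosses between these extremes.\<close>

lemma slab_component_over_segment_component:
  fixes \<gamma> :: "'a::metric_space \<Rightarrow> 'b::euclidean_space"
  assumes path: "generalized_path X \<gamma>" and z: "z1 \<in> \<gamma> ` X" "z2 \<in> \<gamma> ` X"
    and C: "C \<in> components {t \<in> {0..1}. linepath z1 z2 t \<in> slab x u \<mu> j}"
    and pos: "width u (linepath z1 z2 ` C) > 0"
  obtains D where "D \<in> components {p \<in> X. \<gamma> p \<in> slab x u \<mu> j}"
    and "width u (linepath z1 z2 ` C) \<le> width u (\<gamma> ` D)"
proof -
  let ?l = "linepath z1 z2" and ?h = "\<lambda>p. \<gamma> p \<bullet> u"
  have X: "compact X" "connected X" "continuous_on X ?h"
    using path by (auto simp: generalized_path_def intro!: continuous_intros)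
  have Csub: "C \<subseteq> {t \<in> {0..1}. ?l t \<in> slab x u \<mu> j}" "C \<noteq> {}"
    using C in_components_subset in_components_nonempty by blast+
  have "compact {t \<in> {0..1}. ?l t \<bullet> u \<in> {\<mu> * (of_int j + x)..\<mu> * (of_int j + 1 + x)}}"
    by (rule compact_level_sets) (auto intro!: continuous_intros continuous_on_linepath)
  then have "compact C"
    using linepath_slab_component_eq[OF C] by (simp only: slab_preimage_eq)
  then have "compact ((\<lambda>t. ?l t \<bullet> u) ` C)"
    by (auto intro!: compact_continuous_image continuous_intros continuous_on_linepath)
  from diameter_compact_attained[OF this] Csub(2)
  obtain t1 t2 where t: "t1 \<in> C" "t2 \<in> C" "dist (?l t1 \<bullet> u) (?l t2 \<bullet> u) = width u (?l ` C)"
    by (auto simp: width_def image_image)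
  define s r where "s = min (?l t1 \<bullet> u) (?l t2 \<bullet> u)" and "r = max (?l t1 \<bullet> u) (?l t2 \<bullet> u)"
  have w: "width u (?l ` C) = r - s" and sr: "s < r"
    using t(3) pos by (auto simp: s_def r_def dist_real_def)
  have in_slab: "\<mu> * (of_int j + x) \<le> ?l t \<bullet> u" "?l t \<bullet> u \<le> \<mu> * (of_int j + 1 + x)"
    if "t \<in> C" for t
    using that Csub(1) by (auto simp: slab_def)
  have rng: "min (z1 \<bullet> u) (z2 \<bullet> u) \<le> ?l t \<bullet> u" "?l t \<bullet> u \<le> max (z1 \<bullet> u) (z2 \<bullet> u)" if "t \<in> C" for t
  proof -
    have "?l t \<in> closed_segment z1 z2" using that Csub(1) by (auto simp: linepath_in_path)
    then have "?l t \<bullet> u \<in> (\<lambda>z. z \<bullet> u) ` closed_segment z1 z2" by blast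
    also have "\<dots> = closed_segment (z1 \<bullet> u) (z2 \<bullet> u)"
      by (rule closed_segment_linear_image[symmetric])
         (simp add: bounded_linear.linear bounded_linear_inner_left)
    finally show "min (z1 \<bullet> u) (z2 \<bullet> u) \<le> ?l t \<bullet> u" "?l t \<bullet> u \<le> max (z1 \<bullet> u) (z2 \<bullet> u)"
      by (auto simp: closed_segment_eq_real_ivl split: if_splits)
  qed
  \<comment> \<open>Which endpoint projects lower depends on \<open>u\<close>; \<open>p1\<close>
    lies over the lower one.\<close>
  obtain p1 p2 where p: "p1 \<in> X" "p2 \<in> X" "?h p1 = min (z1 \<bullet> u) (z2 \<bullet> u)" "?h p2 = max (z1 \<bullet> u) (z2 \<bullet> u)"
    using z unfolding min_def max_def by (metis (full_types) imageE)
  obtain D a b where D: "D \<in> components {p \<in> X. ?h p \<in> {\<mu> * (of_int j + x)..\<mu> * (of_int j + 1 + x)}}"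
      "a \<in> D" "b \<in> D" "?h a = s" "?h b = r"
  proof (rule crossing_component[OF X p(1,2)])
    show "?h p1 \<le> s" "r \<le> ?h p2" "\<mu> * (of_int j + x) \<le> s" "r \<le> \<mu> * (of_int j + 1 + x)"
      using rng[OF t(1)] rng[OF t(2)] in_slab[OF t(1)] in_slab[OF t(2)] p(3,4)
      by (auto simp: s_def r_def)
  qed (use sr in auto)
  have "D \<subseteq> X" using D(1) in_components_subset by blast
  from abs_inner_diff_le_width[OF path this D(2,3), of u] D(4,5) sr w
  have "width u (?l ` C) \<le> width u (\<gamma> ` D)" by simp
  then show thesis using that D(1) by (simp add: slab_preimage_eq)
qed

text \<open>\<open>C\<close> and \<open>\<phi> C\<close> belong to the same slab. The slab of
  \<open>\<phi> C\<close> is unique and determines \<open>C\<close> as its full preimage, hence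
  injectivity. The third property serves to detect unmatched components.\<close>

lemma segment_component_injection:
  fixes \<gamma> :: "'a::metric_space \<Rightarrow> 'b::euclidean_space"
  assumes path: "generalized_path X \<gamma>" and z: "z1 \<in> \<gamma> ` X" "z2 \<in> \<gamma> ` X" and "\<mu> > 0"
  obtains \<phi> where "inj_on \<phi> (slab_components {0..1} (linepath z1 z2) x u \<mu>)"
    and "\<And>C. C \<in> slab_components {0..1} (linepath z1 z2) x u \<mu> \<Longrightarrow>
      \<phi> C \<in> slab_components X \<gamma> x u \<mu> \<and> width u (linepath z1 z2 ` C) \<le> width u (\<gamma> ` \<phi> C)"
    and "\<And>C j. C \<in> slab_components {0..1} (linepath z1 z2) x u \<mu> \<Longrightarrow>
      \<phi> C \<in> components {p \<in> X. \<gamma> p \<in> slab x u \<mu> j} \<Longrightarrow>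
      C = {t \<in> {0..1}. linepath z1 z2 t \<in> slab x u \<mu> j}"
proof -
  let ?F = "slab_components {0..1} (linepath z1 z2) x u \<mu>"
  define P where "P C D j \<longleftrightarrow> C \<in> components {t \<in> {0..1}. linepath z1 z2 t \<in> slab x u \<mu> j} \<and>
      D \<in> components {p \<in> X. \<gamma> p \<in> slab x u \<mu> j} \<and> width u (linepath z1 z2 ` C) \<le> width u (\<gamma> ` D)"
    for C D j
  have "\<exists>D j. P C D j" if CF: "C \<in> ?F" for C
  proof -
    obtain j where j: "C \<in> components {t \<in> {0..1}. linepath z1 z2 t \<in> slab x u \<mu> j}"
        "width u (linepath z1 z2 ` C) > 0"
      using CF unfolding slab_components_def by blast
    obtain D where "D \<in> components {p \<in> X. \<gamma> p \<in> slab x u \<mu> j}"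
        "width u (linepath z1 z2 ` C) \<le> width u (\<gamma> ` D)"
      by (rule slab_component_over_segment_component[OF path z j])
    with j(1) show ?thesis unfolding P_def by blast
  qed
  then obtain \<phi> J where "\<And>C. C \<in> ?F \<Longrightarrow> P C (\<phi> C) (J C)" by metis
  then have \<phi>: "\<And>C. C \<in> ?F \<Longrightarrow> C \<in> components {t \<in> {0..1}. linepath z1 z2 t \<in> slab x u \<mu> (J C)}"
      "\<And>C. C \<in> ?F \<Longrightarrow> \<phi> C \<in> components {p \<in> X. \<gamma> p \<in> slab x u \<mu> (J C)}"
      "\<And>C. C \<in> ?F \<Longrightarrow> width u (linepath z1 z2 ` C) \<le> width u (\<gamma> ` \<phi> C)"
    unfolding P_def by blast+
  have pos: "0 < width u (\<gamma> ` \<phi> C)" if "C \<in> ?F" for C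
    using \<phi>(3)[OF that] that by (auto simp: slab_components_def)
  have idx: "C = {t \<in> {0..1}. linepath z1 z2 t \<in> slab x u \<mu> j}"
    if "C \<in> ?F" "\<phi> C \<in> components {p \<in> X. \<gamma> p \<in> slab x u \<mu> j}" for C j
  proof -
    have "J C = j" by (rule slab_index_unique[OF \<phi>(2)[OF that(1)] that(2) pos[OF that(1)] \<open>\<mu> > 0\<close>])
    then show ?thesis using linepath_slab_component_eq[OF \<phi>(1)[OF that(1)]] by simp
  qed
  have "inj_on \<phi> ?F"
  proof (rule inj_onI)
    fix C D assume *: "C \<in> ?F" "D \<in> ?F" "\<phi> C = \<phi> D"
    note D = \<phi>(2)[OF *(1), unfolded *(3)]
    show "C = D" by (rule trans[OF idx[OF *(1) \<phi>(2)[OF *(1)]] sym[OF idx[OF *(2) D]]])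
  qed
  moreover have "\<phi> C \<in> slab_components X \<gamma> x u \<mu> \<and>
      width u (linepath z1 z2 ` C) \<le> width u (\<gamma> ` \<phi> C)" if "C \<in> ?F" for C
    using \<phi>(2,3)[OF that] pos[OF that] unfolding slab_components_def by blast
  ultimately show thesis by (rule that) (assumption | rule idx)+
qed

text \<open>The indices of the slabs that the segment meets lie in an interval of length at most
  \<open>norm (z2 - z1) / \<mu> + 1\<close>, which holds at most one integer more than its length.
  The bound is uniform in \<open>x\<close> and \<open>u\<close>.\<close>

lemma card_segment_slab_components:
  fixes z1 z2 :: "'b::euclidean_space"
  assumes "\<mu> > 0" "norm u = 1"
  shows "finite (slab_components {0..1} (linepath z1 z2) x u \<mu>)"
    and "real (card (slab_components {0..1} (linepath z1 z2) x u \<mu>)) \<le> norm (z2 - z1) / \<mu> + 2"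
proof -
  let ?F = "slab_components {0..1} (linepath z1 z2) x u \<mu>" and ?n = "norm (z2 - z1)"
  let ?K = "\<lambda>j. {t \<in> {0..1}. linepath z1 z2 t \<in> slab x u \<mu> j}"
  define a b where "a = min (z1 \<bullet> u) (z2 \<bullet> u)" and "b = max (z1 \<bullet> u) (z2 \<bullet> u)"
  have ab: "a \<le> b" "b - a \<le> ?n"
    using Cauchy_Schwarz_ineq2[of "z2 - z1" u] assms(2)
    by (auto simp: a_def b_def algebra_simps)
  define I where "I = {\<lceil>a / \<mu> - x - 1\<rceil>..\<lfloor>b / \<mu> - x\<rfloor>}"
  have "?F \<subseteq> ?K ` I"
  proof
    fix C assume "C \<in> ?F"
    then obtain j where j: "C \<in> components (?K j)" by (auto simp: slab_components_def)
    then have C: "C = ?K j" by (rule linepath_slab_component_eq)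
    then obtain t where t: "t \<in> {0..1}" "linepath z1 z2 t \<in> slab x u \<mu> j"
      using in_components_nonempty[OF j] by auto
    have "linepath z1 z2 t \<bullet> u \<in> closed_segment (z1 \<bullet> u) (z2 \<bullet> u)"
      using t(1) by (auto simp: closed_segment_def linepath_def inner_add_left)
    then have "a \<le> linepath z1 z2 t \<bullet> u" "linepath z1 z2 t \<bullet> u \<le> b"
      by (auto simp: a_def b_def closed_segment_eq_real_ivl split: if_splits)
    then have "a \<le> \<mu> * (of_int j + 1 + x)" "\<mu> * (of_int j + x) \<le> b"
      using t(2) by (auto simp: slab_def)
    then have "a / \<mu> \<le> of_int j + 1 + x" "of_int j + x \<le> b / \<mu>"
      using assms(1) by (auto simp: field_simps)
    then have "j \<in> I" unfolding I_def atLeastAtMost_iff by linarith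
    then show "C \<in> ?K ` I" using C by blast
  qed
  moreover have "finite I" by (simp add: I_def)
  ultimately show "finite ?F" by (meson finite_imageI finite_subset)
  have "card ?F \<le> card I"
    using \<open>?F \<subseteq> ?K ` I\<close> \<open>finite I\<close> by (meson card_image_le card_mono finite_imageI le_trans)
  also have "real (card I) \<le> (b - a) / \<mu> + 2"
  proof -
    have "(b - a) / \<mu> \<ge> 0" using ab assms(1) by auto
    then show ?thesis unfolding I_def by (simp add: diff_divide_distrib) linarith
  qed
  also have "\<dots> \<le> ?n / \<mu> + 2" using ab assms(1) by (simp add: divide_right_mono)
  finally show "real (card ?F) \<le> ?n / \<mu> + 2" by simp
qed

section \<open>Evaluating and bounding the weighted sum\<close>

text \<open>Opens the \<open>SOME\<close> in \<open>slab_length\<close>: a decreasing enumeration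
  exists, so the chosen pair is one.\<close>

lemma slab_length_witness:
  assumes "generalized_path X \<gamma>" "\<mu> > 0"
  obtains N c where "decreasing_enumeration (\<lambda>C. width u (\<gamma> ` C)) (slab_components X \<gamma> x u \<mu>) N c"
    and "slab_length X \<gamma> x u \<mu> = (\<Sum>k. if enat k < N then ennreal ((1/2) ^ k * width u (\<gamma> ` c k)) else 0)"
proof -
  let ?D = "decreasing_enumeration (\<lambda>C. width u (\<gamma> ` C)) (slab_components X \<gamma> x u \<mu>)"
  obtain N c where Nc: "(SOME (N, c). ?D N c) = (N, c)" by fastforce
  have "\<exists>y. case y of (N, c) \<Rightarrow> ?D N c" using slab_components_enumerable[OF assms] by auto
  then have "case (SOME (N, c). ?D N c) of (N, c) \<Rightarrow> ?D N c" by (rule someI_ex)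
  then have "?D N c" by (simp add: Nc)
  then show thesis using that by (simp add: slab_length_def Let_def Nc)
qed

text \<open>By the rearrangement inequality, distinct components listed in any order give a lower
  bound, so comparisons can be made without sorting.\<close>

lemma slab_length_ge_sum:
  assumes path: "generalized_path X \<gamma>" "\<mu> > 0"
    and d: "inj_on d {..<m}" "\<And>k. k < m \<Longrightarrow> d k \<in> slab_components X \<gamma> x u \<mu>"
  shows "ennreal (\<Sum>k<m. (1/2) ^ k * width u (\<gamma> ` d k)) \<le> slab_length X \<gamma> x u \<mu>"
proof -
  let ?w = "\<lambda>C. width u (\<gamma> ` C)" and ?F = "slab_components X \<gamma> x u \<mu>"
  obtain N c where c: "decreasing_enumeration ?w ?F N c"
    and L: "slab_length X \<gamma> x u \<mu> = (\<Sum>k. if enat k < N then ennreal ((1/2) ^ k * ?w (c k)) else 0)"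
    by (rule slab_length_witness[OF path])
  \<comment> \<open>The value 0 past the end extends the widths to an antitone sequence on all
    naturals.\<close>
  define a where "a k = (if enat k < N then ?w (c k) else 0)" for k
  have bij: "bij_betw c {k. enat k < N} ?F"
    and dec: "\<And>k l. k \<le> l \<Longrightarrow> enat l < N \<Longrightarrow> ?w (c l) \<le> ?w (c k)"
    using c by (auto simp: decreasing_enumeration_def)
  have pos: "0 < ?w (c k)" if "enat k < N" for k
    using bij_betwE[OF bij] that by (auto simp: slab_components_def)
  have a: "0 \<le> a k" for k using pos by (auto simp: a_def less_imp_le)
  have anti: "antimono a"
  proof (rule antimonoI)
    fix k l :: nat assume "k \<le> l"
    moreover from this have "enat k < N" if "enat l < N"
      using that by (meson enat_ord_simps(1) order_le_less_trans)
    ultimately show "a l \<le> a k" using dec[of k l] a[of k] by (auto simp: a_def)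
  qed
  \<comment> \<open>The position of \<open>d k\<close> in the chosen enumeration.\<close>
  define \<pi> where "\<pi> k = inv_into {k. enat k < N} c (d k)" for k
  have \<pi>: "enat (\<pi> k) < N" "c (\<pi> k) = d k" if "k < m" for k
  proof -
    have "d k \<in> c ` {k. enat k < N}" using d(2)[OF that] bij by (simp add: bij_betw_def)
    then show "enat (\<pi> k) < N" "c (\<pi> k) = d k"
      unfolding \<pi>_def using inv_into_into[of "d k" c "{k. enat k < N}"] f_inv_into_f[of "d k" c]
      by simp_all
  qed
  have "inj_on \<pi> {..<m}"
    using d(1) \<pi>(2) by (metis (mono_tags, lifting) inj_on_def lessThan_iff)
  from rearrangement_injection[OF _ _ anti this, of "\<lambda>k. (1/2) ^ k"]
  have "(\<Sum>k<m. (1/2) ^ k * a (\<pi> k)) \<le> (\<Sum>k<m. (1/2) ^ k * a k)"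
    by (auto simp: antimono_iff_le_Suc)
  moreover have "(\<Sum>k<m. (1/2) ^ k * a (\<pi> k)) = (\<Sum>k<m. (1/2) ^ k * ?w (d k))"
    using \<pi> by (intro sum.cong) (auto simp: a_def)
  ultimately have "ennreal (\<Sum>k<m. (1/2) ^ k * ?w (d k)) \<le> ennreal (\<Sum>k<m. (1/2) ^ k * a k)"
    by (simp add: ennreal_leI)
  also have "\<dots> = (\<Sum>k<m. ennreal ((1/2) ^ k * a k))"
    using a by (simp add: sum_ennreal)
  also have "\<dots> \<le> (\<Sum>k. ennreal ((1/2) ^ k * a k))"
    by (rule sum_le_suminf) auto
  also have "\<dots> = slab_length X \<gamma> x u \<mu>"
    unfolding L by (intro suminf_cong) (auto simp: a_def)
  finally show ?thesis .
qed

lemma slab_length_eq_sum: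
  assumes path: "generalized_path X \<gamma>" "\<mu> > 0" and fin: "finite (slab_components X \<gamma> x u \<mu>)"
  obtains c where "bij_betw c {..<card (slab_components X \<gamma> x u \<mu>)} (slab_components X \<gamma> x u \<mu>)"
    and "slab_length X \<gamma> x u \<mu> =
      ennreal (\<Sum>k<card (slab_components X \<gamma> x u \<mu>). (1/2) ^ k * width u (\<gamma> ` c k))"
proof -
  let ?w = "\<lambda>C. width u (\<gamma> ` C)" and ?F = "slab_components X \<gamma> x u \<mu>"
  obtain N c where c: "decreasing_enumeration ?w ?F N c"
    and L: "slab_length X \<gamma> x u \<mu> = (\<Sum>k. if enat k < N then ennreal ((1/2) ^ k * ?w (c k)) else 0)"
    by (rule slab_length_witness[OF path])
  have bij: "bij_betw c {k. enat k < N} ?F" using c by (auto simp: decreasing_enumeration_def)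
  obtain n where n: "N = enat n"
  proof (cases N)
    case infinity
    then have "finite (UNIV :: nat set)" using bij_betw_finite[OF bij] fin by simp
    then show ?thesis by simp
  qed
  then have bij': "bij_betw c {..<n} ?F" using bij by (simp add: lessThan_def)
  then have card: "card ?F = n" using bij_betw_same_card by fastforce
  have nonneg: "0 \<le> ?w (c k)" if "k < n" for k
    using bij_betwE[OF bij'] that by (auto simp: slab_components_def less_imp_le)
  have "slab_length X \<gamma> x u \<mu> = (\<Sum>k<n. if enat k < N then ennreal ((1/2) ^ k * ?w (c k)) else 0)"
    unfolding L using n by (intro suminf_finite) auto
  also have "\<dots> = (\<Sum>k<n. ennreal ((1/2) ^ k * ?w (c k)))"
    using n by (intro sum.cong) auto
  also have "\<dots> = ennreal (\<Sum>k<n. (1/2) ^ k * ?w (c k))"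
    using nonneg by (intro sum_ennreal) auto
  finally show thesis using that bij' card by simp
qed

section \<open>Pointwise comparison of the integrands\<close>

text \<open>Each component of the segment is replaced, at its own position, by its counterpart,
  which is no narrower. The new list may fail to decrease but still bounds from below.\<close>

lemma slab_length_segment_le:
  fixes \<gamma> :: "'a::metric_space \<Rightarrow> 'b::euclidean_space"
  assumes path: "generalized_path X \<gamma>" and z: "z1 \<in> \<gamma> ` X" "z2 \<in> \<gamma> ` X" and "\<mu> > 0" "norm u = 1"
  shows "slab_length {0..1} (linepath z1 z2) x u \<mu> \<le> slab_length X \<gamma> x u \<mu>"
proof -
  let ?F = "slab_components {0..1} (linepath z1 z2) x u \<mu>"
  note fin = card_segment_slab_components(1)[OF \<open>\<mu> > 0\<close> \<open>norm u = 1\<close>]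
  obtain c where c: "bij_betw c {..<card ?F} ?F"
    and L: "slab_length {0..1} (linepath z1 z2) x u \<mu> =
      ennreal (\<Sum>k<card ?F. (1/2) ^ k * width u (linepath z1 z2 ` c k))"
    by (rule slab_length_eq_sum[OF generalized_path_linepath \<open>\<mu> > 0\<close> fin])
  obtain \<phi> where \<phi>: "inj_on \<phi> ?F" "\<And>C. C \<in> ?F \<Longrightarrow> \<phi> C \<in> slab_components X \<gamma> x u \<mu> \<and>
      width u (linepath z1 z2 ` C) \<le> width u (\<gamma> ` \<phi> C)"
    by (rule segment_component_injection[OF path z \<open>\<mu> > 0\<close>, of x u]) blast
  have cF: "c k \<in> ?F" if "k < card ?F" for k using bij_betwE[OF c] that by auto
  have "slab_length {0..1} (linepath z1 z2) x u \<mu> \<le>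
      ennreal (\<Sum>k<card ?F. (1/2) ^ k * width u (\<gamma> ` (\<phi> \<circ> c) k))"
    unfolding L using \<phi>(2)[OF cF] by (auto intro!: ennreal_leI sum_mono mult_left_mono)
  also have "\<dots> \<le> slab_length X \<gamma> x u \<mu>"
  proof (rule slab_length_ge_sum[OF path \<open>\<mu> > 0\<close>])
    show "inj_on (\<phi> \<circ> c) {..<card ?F}"
      using c \<phi>(1) by (auto simp: bij_betw_def intro: comp_inj_on)
  qed (use \<phi>(2)[OF cF] in auto)
  finally show ?thesis .
qed

text \<open>The segment has at most one component in slab \<open>j\<close>, so at most one member of
  \<open>\<D>\<close> is matched, and none if the slab misses the segment. A member left over is
  appended after the matched ones, where its weight is at least \<open>(1/2) ^ N\<close>.\<close>

lemma slab_length_segment_plus_extra_le: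
  fixes \<gamma> :: "'a::metric_space \<Rightarrow> 'b::euclidean_space"
  assumes path: "generalized_path X \<gamma>" and z: "z1 \<in> \<gamma> ` X" "z2 \<in> \<gamma> ` X" and "\<mu> > 0" "norm u = 1"
    and N: "norm (z2 - z1) / \<mu> + 2 \<le> real N" and "0 < \<eta>"
    and \<D>: "\<D> \<subseteq> components {p \<in> X. \<gamma> p \<in> slab x u \<mu> j}" "\<And>D. D \<in> \<D> \<Longrightarrow> \<eta> \<le> width u (\<gamma> ` D)"
    and D1: "D1 \<in> \<D>"
    and extra: "{t \<in> {0..1}. linepath z1 z2 t \<in> slab x u \<mu> j} = {} \<or> (\<exists>D2 \<in> \<D>. D2 \<noteq> D1)"
  shows "slab_length {0..1} (linepath z1 z2) x u \<mu> + ennreal ((1/2) ^ N * \<eta>) \<le> slab_length X \<gamma> x u \<mu>"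
proof -
  let ?F = "slab_components {0..1} (linepath z1 z2) x u \<mu>" and ?G = "slab_components X \<gamma> x u \<mu>"
  let ?K = "{t \<in> {0..1}. linepath z1 z2 t \<in> slab x u \<mu> j}"
  define K where "K = card ?F"
  note fin = card_segment_slab_components(1)[OF \<open>\<mu> > 0\<close> \<open>norm u = 1\<close>]
  have KN: "K \<le> N"
    using card_segment_slab_components(2)[OF \<open>\<mu> > 0\<close> \<open>norm u = 1\<close>, of z1 z2 x] N by (simp add: K_def)
  obtain c where c: "bij_betw c {..<K} ?F"
    and L: "slab_length {0..1} (linepath z1 z2) x u \<mu> =
      ennreal (\<Sum>k<K. (1/2) ^ k * width u (linepath z1 z2 ` c k))"
    unfolding K_def by (rule slab_length_eq_sum[OF generalized_path_linepath \<open>\<mu> > 0\<close> fin])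
  obtain \<phi> where \<phi>: "inj_on \<phi> ?F" "\<And>C. C \<in> ?F \<Longrightarrow> \<phi> C \<in> ?G \<and>
      width u (linepath z1 z2 ` C) \<le> width u (\<gamma> ` \<phi> C)"
      "\<And>C j. C \<in> ?F \<Longrightarrow> \<phi> C \<in> components {p \<in> X. \<gamma> p \<in> slab x u \<mu> j} \<Longrightarrow>
        C = {t \<in> {0..1}. linepath z1 z2 t \<in> slab x u \<mu> j}"
    by (rule segment_component_injection[OF path z \<open>\<mu> > 0\<close>, of x u]) blast
  have cF: "c k \<in> ?F" if "k < K" for k using bij_betwE[OF c] that by auto
  have F_ne: "C \<noteq> {}" if "C \<in> ?F" for C
    using that in_components_nonempty by (fastforce simp: slab_components_def)
  have \<D>G: "\<D> \<subseteq> ?G"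
    using \<D> \<open>0 < \<eta>\<close> by (force simp: slab_components_def)
  have \<phi>K: "C = ?K" if "C \<in> ?F" "\<phi> C \<in> \<D>" for C
    using \<phi>(3)[OF that(1)] that(2) \<D>(1) by blast
  have "\<exists>D \<in> \<D>. D \<notin> \<phi> ` ?F"
  proof (cases "?K = {}")
    case True
    then have "D1 \<notin> \<phi> ` ?F" using \<phi>K F_ne D1 by blast
    then show ?thesis using D1 by blast
  next
    case False
    then obtain D2 where D2: "D2 \<in> \<D>" "D2 \<noteq> D1" using extra by blast
    show ?thesis
    proof (rule ccontr)
      assume "\<not> ?thesis"
      then have all: "D \<in> \<D> \<Longrightarrow> D \<in> \<phi> ` ?F" for D by metis
      obtain C1 where C1: "D1 = \<phi> C1" "C1 \<in> ?F" using all[OF D1] by (rule imageE)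
      obtain C2 where C2: "D2 = \<phi> C2" "C2 \<in> ?F" using all[OF D2(1)] by (rule imageE)
      have "C1 = ?K" by (rule \<phi>K[OF C1(2) D1[unfolded C1(1)]])
      moreover have "C2 = ?K" by (rule \<phi>K[OF C2(2) D2(1)[unfolded C2(1)]])
      ultimately have "C1 = C2" by (rule trans[OF _ sym])
      then show False using C1(1) C2(1) D2(2) by simp
    qed
  qed
  then obtain D where D: "D \<in> \<D>" "D \<notin> \<phi> ` ?F" by blast
  \<comment> \<open>Positions below \<open>K\<close> carry the matched components and position
    \<open>K\<close> the additional one, hence the length \<open>Suc K\<close>.\<close>
  define d where "d k = (if k < K then \<phi> (c k) else D)" for k
  have inj: "inj_on d {..<Suc K}"
  proof -
    have "inj_on (\<phi> \<circ> c) {..<K}"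
      using c \<phi>(1) by (auto simp: bij_betw_def intro: comp_inj_on)
    then have "inj_on d {..<K}" by (auto simp: inj_on_def d_def)
    moreover have "d K \<notin> d ` {..<K}" using D(2) cF by (auto simp: d_def)
    ultimately show ?thesis by (auto simp: lessThan_Suc)
  qed
  have nonneg: "0 \<le> width u (linepath z1 z2 ` c k)" if "k < K" for k
    using cF[OF that] by (auto simp: slab_components_def less_imp_le)
  have "slab_length {0..1} (linepath z1 z2) x u \<mu> + ennreal ((1/2) ^ N * \<eta>)
      = ennreal ((\<Sum>k<K. (1/2) ^ k * width u (linepath z1 z2 ` c k)) + (1/2) ^ N * \<eta>)"
    unfolding L using nonneg \<open>0 < \<eta>\<close> by (intro ennreal_plus[symmetric] sum_nonneg) auto
  also have "\<dots> \<le> ennreal (\<Sum>k<Suc K. (1/2) ^ k * width u (\<gamma> ` d k))"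
  proof (rule ennreal_leI)
    have "(\<Sum>k<K. (1/2) ^ k * width u (linepath z1 z2 ` c k)) \<le> (\<Sum>k<K. (1/2) ^ k * width u (\<gamma> ` d k))"
      using \<phi>(2)[OF cF] by (auto intro!: sum_mono mult_left_mono simp: d_def)
    moreover have "(1/2) ^ N * \<eta> \<le> (1/2) ^ K * width u (\<gamma> ` D)"
      using KN \<D>(2)[OF D(1)] \<open>0 < \<eta>\<close> by (intro mult_mono power_decreasing) auto
    ultimately show "(\<Sum>k<K. (1/2) ^ k * width u (linepath z1 z2 ` c k)) + (1/2) ^ N * \<eta>
        \<le> (\<Sum>k<Suc K. (1/2) ^ k * width u (\<gamma> ` d k))"
      by (simp add: d_def)
  qed
  also have "\<dots> \<le> slab_length X \<gamma> x u \<mu>"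
  proof (rule slab_length_ge_sum[OF path \<open>\<mu> > 0\<close> inj])
    show "d k \<in> ?G" if "k < Suc K" for k
      using \<phi>(2)[OF cF] D(1) \<D>G by (auto simp: d_def)
  qed
  finally show ?thesis .
qed

section \<open>Passing to the integrals\<close>

text \<open>The geometric weights sum to at most 2, and by Cauchy-Schwarz no width exceeds the
  length of the segment.\<close>

lemma slab_length_segment_upper_bound:
  fixes z1 z2 :: "'b::euclidean_space"
  assumes "\<mu> > 0" "norm u = 1"
  shows "slab_length {0..1} (linepath z1 z2) x u \<mu> \<le> ennreal (2 * norm (z2 - z1))"
proof -
  let ?F = "slab_components {0..1} (linepath z1 z2) x u \<mu>" and ?n = "norm (z2 - z1)"
  obtain c where c: "bij_betw c {..<card ?F} ?F"
    and L: "slab_length {0..1} (linepath z1 z2) x u \<mu> =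
      ennreal (\<Sum>k<card ?F. (1/2) ^ k * width u (linepath z1 z2 ` c k))"
    by (rule slab_length_eq_sum[OF generalized_path_linepath \<open>\<mu> > 0\<close> card_segment_slab_components(1)[OF assms]])
  have w: "width u (linepath z1 z2 ` C) \<le> ?n" if "C \<in> ?F" for C
  proof -
    have C: "C \<subseteq> {0..1}"
      using that in_components_subset unfolding slab_components_def by blast
    have "diameter ((\<lambda>z. z \<bullet> u) ` linepath z1 z2 ` C) \<le> ?n"
    proof (rule diameter_le)
      fix a b assume "a \<in> (\<lambda>z. z \<bullet> u) ` linepath z1 z2 ` C" "b \<in> (\<lambda>z. z \<bullet> u) ` linepath z1 z2 ` C"
      then obtain s t where st: "s \<in> C" "t \<in> C" "a = linepath z1 z2 s \<bullet> u" "b = linepath z1 z2 t \<bullet> u" by blast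
      have "\<bar>s - t\<bar> \<le> 1" using subsetD[OF C st(1)] subsetD[OF C st(2)] by auto
      moreover have "\<bar>(z2 - z1) \<bullet> u\<bar> \<le> ?n"
        using Cauchy_Schwarz_ineq2[of "z2 - z1" u] assms(2) by simp
      ultimately have "\<bar>s - t\<bar> * \<bar>(z2 - z1) \<bullet> u\<bar> \<le> 1 * ?n" by (intro mult_mono) auto
      moreover have "a - b = (s - t) * ((z2 - z1) \<bullet> u)"
        by (simp add: st linepath_inner algebra_simps)
      ultimately show "norm (a - b) \<le> ?n" by (simp add: abs_mult)
    qed simp
    then show ?thesis by (simp add: width_def)
  qed
  have "(\<Sum>k<card ?F. (1/2) ^ k * width u (linepath z1 z2 ` c k)) \<le> (\<Sum>k<card ?F. (1/2) ^ k * ?n)"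
    using w bij_betwE[OF c] by (intro sum_mono mult_left_mono) auto
  also have "\<dots> = (\<Sum>k<card ?F. (1/2::real) ^ k) * ?n" by (simp add: sum_distrib_right)
  also have "\<dots> \<le> 2 * ?n"
    by (intro mult_right_mono) (auto simp: sum_gp_strict)
  finally show ?thesis unfolding L by (rule ennreal_leI)
qed

text \<open>The integrand is bounded and all three domains have measure 1. Finiteness is what turns
  an additive gain into a strict inequality.\<close>

lemma len_segment_finite: "len {0..1} (linepath z1 (z2::'b::euclidean_space)) < \<infinity>"
proof -
  let ?n = "ennreal (2 * norm (z2 - z1))"
  have "len {0..1} (linepath z1 z2) \<le>
      (\<integral>\<^sup>+\<mu>\<in>{0<..1::real}. (\<integral>\<^sup>+u. (\<integral>\<^sup>+x\<in>{0..1::real}. ?n \<partial>lborel) \<partial>(sphere_measure :: 'b measure)) \<partial>lborel)"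
    unfolding len_def
  proof (intro nn_integral_mono)
    fix \<mu> :: real
    have "(\<integral>\<^sup>+u. (\<integral>\<^sup>+x\<in>{0..1}. slab_length {0..1} (linepath z1 z2) x u \<mu> \<partial>lborel) \<partial>sphere_measure)
        \<le> (\<integral>\<^sup>+u. (\<integral>\<^sup>+x\<in>{0..1::real}. ?n \<partial>lborel) \<partial>(sphere_measure :: 'b measure))" if "0 < \<mu>"
      using that by (intro nn_integral_mono mult_right_mono slab_length_segment_upper_bound) auto
    then show "(\<integral>\<^sup>+u. (\<integral>\<^sup>+x\<in>{0..1}. slab_length {0..1} (linepath z1 z2) x u \<mu> \<partial>lborel) \<partial>sphere_measure) * indicator {0<..1} \<mu>
        \<le> (\<integral>\<^sup>+u. (\<integral>\<^sup>+x\<in>{0..1::real}. ?n \<partial>lborel) \<partial>(sphere_measure :: 'b measure)) * indicator {0<..1} \<mu>"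
      by (cases "\<mu> \<in> {0<..1}") (simp_all del: nn_integral_const)
  qed
  also have "\<dots> = ?n"
    by (simp add: nn_integral_cmult emeasure_sphere_measure_space)
  finally show ?thesis by (simp add: le_less_trans)
qed

lemma len_segment_le:
  fixes \<gamma> :: "'a::metric_space \<Rightarrow> 'b::euclidean_space"
  assumes path: "generalized_path X \<gamma>" and z: "z1 \<in> \<gamma> ` X" "z2 \<in> \<gamma> ` X"
  shows "len {0..1} (linepath z1 z2) \<le> len X \<gamma>"
  unfolding len_def
proof (intro nn_integral_mono)
  fix \<mu> :: real
  show "(\<integral>\<^sup>+u. (\<integral>\<^sup>+x\<in>{0..1}. slab_length {0..1} (linepath z1 z2) x u \<mu> \<partial>lborel) \<partial>sphere_measure) * indicator {0<..1} \<mu>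
      \<le> (\<integral>\<^sup>+u. (\<integral>\<^sup>+x\<in>{0..1}. slab_length X \<gamma> x u \<mu> \<partial>lborel) \<partial>sphere_measure) * indicator {0<..1} \<mu>"
    by (auto split: split_indicator intro!: nn_integral_mono mult_right_mono slab_length_segment_le[OF path z])
qed

text \<open>A uniform gain \<open>\<delta>\<close> on a set of positive measure survives
  integration. The interval for \<open>x\<close> may move with \<open>\<mu>\<close> and
  \<open>u\<close>, since the inner integral gains the same amount wherever it lies.\<close>

lemma len_segment_less:
  fixes \<gamma> :: "'a::metric_space \<Rightarrow> 'b::euclidean_space"
  assumes path: "generalized_path X \<gamma>" and z: "z1 \<in> \<gamma> ` X" "z2 \<in> \<gamma> ` X"
    and U: "open U" "u0 \<in> U" "norm u0 = 1" and m: "0 < m" "m \<le> 1" and "0 < \<delta>"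
    and gap: "\<And>\<mu> u. m / 2 \<le> \<mu> \<Longrightarrow> \<mu> \<le> m \<Longrightarrow> u \<in> U \<Longrightarrow> norm u = 1 \<Longrightarrow>
      \<exists>c. 0 \<le> c \<and> c + 1/4 \<le> 1 \<and> (\<forall>x\<in>{c..c + 1/4}.
        slab_length {0..1} (linepath z1 z2) x u \<mu> + ennreal \<delta> \<le> slab_length X \<gamma> x u \<mu>)"
  shows "len {0..1} (linepath z1 z2) < len X \<gamma>"
proof -
  let ?S = "sphere_measure :: 'b measure"
  let ?f = "\<lambda>x u \<mu>. slab_length {0..1} (linepath z1 z2) x u \<mu>" and ?g = "\<lambda>x u \<mu>. slab_length X \<gamma> x u \<mu>"
  let ?F = "\<lambda>\<mu> u. \<integral>\<^sup>+x\<in>{0..1}. ?f x u \<mu> \<partial>lborel" and ?G = "\<lambda>\<mu> u. \<integral>\<^sup>+x\<in>{0..1}. ?g x u \<mu> \<partial>lborel"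
  let ?U = "sphere 0 1 \<inter> U"
  have mU: "?U \<in> sets ?S"
    using U(1) by (auto simp: sets_sphere_measure sets_restrict_space_iff)
  define \<epsilon> where "\<epsilon> = ennreal \<delta> * ennreal (1/4)"
  define \<sigma> where "\<sigma> = emeasure ?S ?U"
  have le: "?F \<mu> u \<le> ?G \<mu> u" if "0 < \<mu>" "norm u = 1" for \<mu> u
    by (auto split: split_indicator intro!: nn_integral_mono slab_length_segment_le[OF path z that])
  \<comment> \<open>The indicator extends the estimate to every unit \<open>u\<close> and leaves the
    added term measurable, as superadditivity requires.\<close>
  have inner: "?F \<mu> u + \<epsilon> * indicator ?U u \<le> ?G \<mu> u"
    if \<mu>: "m / 2 \<le> \<mu>" "\<mu> \<le> m" and u: "norm u = 1" for \<mu> u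
  proof (cases "u \<in> U")
    case True
    obtain c where c: "0 \<le> c" "c + 1/4 \<le> 1"
      and gt: "\<And>x. x \<in> {c..c + 1/4} \<Longrightarrow> ?f x u \<mu> + ennreal \<delta> \<le> ?g x u \<mu>"
      using gap[OF \<mu> True u] by blast
    have "?F \<mu> u + \<epsilon> = ?F \<mu> u + (\<integral>\<^sup>+x. ennreal \<delta> * indicator {c..c + 1/4} x \<partial>lborel)"
      by (simp add: nn_integral_cmult_indicator \<epsilon>_def)
    also have "\<dots> \<le> (\<integral>\<^sup>+x. ?f x u \<mu> * indicator {0..1} x + ennreal \<delta> * indicator {c..c + 1/4} x \<partial>lborel)"
      by (rule nn_integral_superadd) measurable
    also have "\<dots> \<le> ?G \<mu> u"
    proof (intro nn_integral_mono)
      fix x :: real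
      show "?f x u \<mu> * indicator {0..1} x + ennreal \<delta> * indicator {c..c + 1/4} x \<le> ?g x u \<mu> * indicator {0..1} x"
        using gt[of x] c slab_length_segment_le[OF path z, of \<mu> u x] \<mu> m u
        by (auto split: split_indicator)
    qed
    finally show ?thesis using True u by simp
  next
    case False
    then show ?thesis using le[of \<mu> u] \<mu> m u by auto
  qed
  have middle: "(\<integral>\<^sup>+u. ?F \<mu> u \<partial>?S) + \<epsilon> * \<sigma> \<le> (\<integral>\<^sup>+u. ?G \<mu> u \<partial>?S)"
    if \<mu>: "m / 2 \<le> \<mu>" "\<mu> \<le> m" for \<mu>
  proof -
    have "(\<integral>\<^sup>+u. ?F \<mu> u \<partial>?S) + \<epsilon> * \<sigma> = (\<integral>\<^sup>+u. ?F \<mu> u \<partial>?S) + (\<integral>\<^sup>+u. \<epsilon> * indicator ?U u \<partial>?S)"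
      using mU by (simp add: nn_integral_cmult_indicator \<sigma>_def)
    also have "\<dots> \<le> (\<integral>\<^sup>+u. ?F \<mu> u + \<epsilon> * indicator ?U u \<partial>?S)"
      using mU by (intro nn_integral_superadd borel_measurable_times_ennreal borel_measurable_indicator) auto
    also have "\<dots> \<le> (\<integral>\<^sup>+u. ?G \<mu> u \<partial>?S)"
      using inner[OF \<mu>] by (intro nn_integral_mono) simp
    finally show ?thesis .
  qed
  have "len {0..1} (linepath z1 z2) + \<epsilon> * \<sigma> * ennreal (m / 2) =
      len {0..1} (linepath z1 z2) + (\<integral>\<^sup>+\<mu>. \<epsilon> * \<sigma> * indicator {m/2..m} \<mu> \<partial>lborel)"
    using m by (simp add: nn_integral_cmult_indicator)
  also have "\<dots> \<le> (\<integral>\<^sup>+\<mu>. (\<integral>\<^sup>+u. ?F \<mu> u \<partial>?S) * indicator {0<..1} \<mu> + \<epsilon> * \<sigma> * indicator {m/2..m} \<mu> \<partial>lborel)"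
    unfolding len_def by (rule nn_integral_superadd) measurable
  also have "\<dots> \<le> len X \<gamma>"
    unfolding len_def
  proof (intro nn_integral_mono)
    fix \<mu> :: real
    have "(\<integral>\<^sup>+u. ?F \<mu> u \<partial>?S) \<le> (\<integral>\<^sup>+u. ?G \<mu> u \<partial>?S)" if "0 < \<mu>"
      by (rule nn_integral_mono) (use le[OF that] in simp)
    then show "(\<integral>\<^sup>+u. ?F \<mu> u \<partial>?S) * indicator {0<..1} \<mu> + \<epsilon> * \<sigma> * indicator {m/2..m} \<mu>
        \<le> (\<integral>\<^sup>+u. ?G \<mu> u \<partial>?S) * indicator {0<..1} \<mu>"
      using middle[of \<mu>] m by (auto split: split_indicator)
  qed
  finally have *: "len {0..1} (linepath z1 z2) + \<epsilon> * \<sigma> * ennreal (m / 2) \<le> len X \<gamma>" .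
  have "0 < \<epsilon> * \<sigma> * ennreal (m / 2)"
    using emeasure_sphere_measure_pos[OF U] m \<open>0 < \<delta>\<close>
    by (simp add: \<epsilon>_def \<sigma>_def ennreal_zero_less_mult_iff)
  \<comment> \<open>An infinite length of the segment would absorb the gain.\<close>
  then have "len {0..1} (linepath z1 z2) < len {0..1} (linepath z1 z2) + \<epsilon> * \<sigma> * ennreal (m / 2)"
    using len_segment_finite[of z1 z2] by (simp add: ennreal_add_left_cancel_less less_top[symmetric])
  with * show ?thesis by (rule less_le_trans[rotated])
qed

section \<open>An image that leaves the segment\<close>

lemma len_segment_less_outside:
  fixes \<gamma> :: "'a::metric_space \<Rightarrow> 'b::euclidean_space"
  assumes path: "generalized_path X \<gamma>" and z: "z1 \<in> \<gamma> ` X" "z2 \<in> \<gamma> ` X"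
    and w: "w \<in> \<gamma> ` X" "w \<notin> closed_segment z1 z2"
  shows "len {0..1} (linepath z1 z2) < len X \<gamma>"
proof -
  obtain a b where ab: "a \<bullet> w < b" "\<And>y. y \<in> closed_segment z1 z2 \<Longrightarrow> a \<bullet> y > b"
    using separating_hyperplane_closed_point[OF convex_closed_segment closed_segment w(2)] by blast
  have az: "a \<bullet> z1 > b" "a \<bullet> z2 > b" using ab(2) by auto
  then have a0: "a \<noteq> 0" using ab(1) by auto
  \<comment> \<open>The hyperplane has the segment on its higher side; the reversed sign raises
    \<open>w\<close> above it.\<close>
  define u0 where "u0 = - sgn a"
  \<comment> \<open>The height of \<open>w\<close> above the higher endpoint; directions in
    \<open>U\<close> below keep more than half of it.\<close>
  define g where "g = min ((w - z1) \<bullet> u0) ((w - z2) \<bullet> u0)"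
  have "(w - y) \<bullet> u0 = (a \<bullet> y - a \<bullet> w) / norm a" for y
    by (simp add: u0_def sgn_div_norm inner_commute algebra_simps divide_inverse inner_diff_left)
  then have g: "0 < g" using az ab(1) a0 by (simp add: g_def)
  define U where "U = {u. (w - z1) \<bullet> u > g / 2} \<inter> {u. (w - z2) \<bullet> u > g / 2}"
  \<comment> \<open>For \<open>\<mu> \<le> g / 4\<close>, two slab widths fit into the remaining
    height \<open>g / 2\<close>.\<close>
  define m where "m = min 1 (g / 4)"
  have m: "0 < m" "m \<le> 1" "m \<le> g / 4" using g by (auto simp: m_def)
  \<comment> \<open>Evaluated at \<open>m / 2\<close>, the smallest \<open>\<mu>\<close> in range,
    so that one \<open>N\<close> serves all.\<close>
  define N where "N = nat \<lceil>norm (z2 - z1) / (m / 2) + 2\<rceil>"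
  have X: "compact X" "connected X" and cont: "\<And>u. continuous_on X (\<lambda>p. \<gamma> p \<bullet> u)"
    using path by (auto simp: generalized_path_def intro!: continuous_intros)
  show ?thesis
  proof (rule len_segment_less[OF path z, where m = m and \<delta> = "(1/2) ^ N * (m / 2)"])
    show "open U" unfolding U_def by (intro open_Int open_halfspace_gt)
    show "u0 \<in> U" using g by (auto simp: U_def g_def)
    show "norm u0 = 1" using a0 by (simp add: u0_def norm_sgn)
    show "0 < (1/2) ^ N * (m / 2)" using m by simp
    show "\<exists>c. 0 \<le> c \<and> c + 1/4 \<le> 1 \<and> (\<forall>x\<in>{c..c + 1/4}.
        slab_length {0..1} (linepath z1 z2) x u \<mu> + ennreal ((1/2) ^ N * (m / 2)) \<le> slab_length X \<gamma> x u \<mu>)"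
      if \<mu>: "m / 2 \<le> \<mu>" "\<mu> \<le> m" and u: "u \<in> U" "norm u = 1" for \<mu> u
    \<comment> \<open>Every offset \<open>x\<close> works, so \<open>c = 0\<close> will do.\<close>
    proof (intro exI[of _ 0] conjI ballI)
      fix x :: real
      define b where "b = max (z1 \<bullet> u) (z2 \<bullet> u)"
      \<comment> \<open>The first slab with its lower face strictly above the segment; its upper
        face is at most \<open>2 * \<mu>\<close> above \<open>b\<close>.\<close>
      define j where "j = \<lfloor>b / \<mu> - x\<rfloor> + 1"
      have \<mu>0: "0 < \<mu>" using \<mu> m by simp
      have "b / \<mu> < of_int j + x" "of_int j + 1 + x \<le> b / \<mu> + 2" unfolding j_def by linarith+
      then have j: "b < \<mu> * (of_int j + x)" "\<mu> * (of_int j + 1 + x) \<le> b + 2 * \<mu>"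
        using \<mu>0 by (simp_all add: field_simps)
      have wu: "b + 2 * \<mu> \<le> w \<bullet> u"
        using u(1) \<mu> m by (auto simp: b_def U_def inner_diff_left)
      obtain p q where pq: "p \<in> X" "q \<in> X" "\<gamma> p = z1" "\<gamma> q = w" using z w by blast
      obtain D s t where D: "D \<in> components {p \<in> X. \<gamma> p \<bullet> u \<in> {\<mu> * (of_int j + x)..\<mu> * (of_int j + 1 + x)}}"
          "s \<in> D" "t \<in> D" "\<gamma> s \<bullet> u = \<mu> * (of_int j + x)" "\<gamma> t \<bullet> u = \<mu> * (of_int j + 1 + x)"
      proof (rule crossing_component[OF X cont pq(1,2)])
        show "\<gamma> p \<bullet> u \<le> \<mu> * (of_int j + x)" using j(1) pq(3) by (simp add: b_def)
        show "\<mu> * (of_int j + 1 + x) \<le> \<gamma> q \<bullet> u" using j(2) wu pq(4) by simp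
        show "\<mu> * (of_int j + x) < \<mu> * (of_int j + 1 + x)" using \<mu>0 by simp
      qed auto
      have "D \<subseteq> X" using D(1) in_components_subset by blast
      have "\<mu> \<le> width u (\<gamma> ` D)"
        using abs_inner_diff_le_width[OF path \<open>D \<subseteq> X\<close> D(3,2), of u] D(4,5) \<mu>0 by (simp add: algebra_simps)
      show "slab_length {0..1} (linepath z1 z2) x u \<mu> + ennreal ((1/2) ^ N * (m / 2)) \<le> slab_length X \<gamma> x u \<mu>"
      proof (rule slab_length_segment_plus_extra_le[OF path z \<mu>0 u(2), where \<D> = "{D}" and j = j])
        have "norm (z2 - z1) / \<mu> \<le> norm (z2 - z1) / (m / 2)"
          using \<mu> m by (intro divide_left_mono) auto
        then show "norm (z2 - z1) / \<mu> + 2 \<le> real N" unfolding N_def by linarith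
        show "{D} \<subseteq> components {p \<in> X. \<gamma> p \<in> slab x u \<mu> j}" using D(1) by (simp add: slab_preimage_eq)
        have "linepath z1 z2 t \<bullet> u \<le> b" if "t \<in> {0..1}" for t
        proof -
          have "(1 - t) * (z1 \<bullet> u) + t * (z2 \<bullet> u) \<le> (1 - t) * b + t * b"
            using that by (intro add_mono mult_left_mono) (auto simp: b_def)
          then show ?thesis by (simp add: linepath_def inner_add_left algebra_simps)
        qed
        then show "{t \<in> {0..1}. linepath z1 z2 t \<in> slab x u \<mu> j} = {} \<or> (\<exists>D2\<in>{D}. D2 \<noteq> D)"
          using j(1) by (fastforce simp: slab_def)
      qed (use m \<mu> \<open>\<mu> \<le> width u (\<gamma> ` D)\<close> in auto)
    qed auto
  qed (use m in auto)
qed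

section \<open>A disconnected fibre\<close>

text \<open>The two closed pieces of \<open>S\<close> are thickened to disjoint open sets by asking
  which piece is nearer.\<close>

lemma compact_disconnected_split:
  fixes S :: "'a::metric_space set"
  assumes "compact S" "\<not> connected S"
  obtains U V where "open U" "open V" "U \<inter> V = {}" "S \<subseteq> U \<union> V" "U \<inter> S \<noteq> {}" "V \<inter> S \<noteq> {}"
proof -
  obtain A B where AB: "closed A" "closed B" "S \<subseteq> A \<union> B" "A \<inter> B \<inter> S = {}" "A \<inter> S \<noteq> {}" "B \<inter> S \<noteq> {}"
    using assms(2) unfolding connected_closed by blast
  define P Q where "P = A \<inter> S" and "Q = B \<inter> S"
  have PQ: "closed P" "closed Q" "P \<noteq> {}" "Q \<noteq> {}" "P \<inter> Q = {}" "S = P \<union> Q"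
    using AB assms(1) by (auto simp: P_def Q_def intro!: closed_Int compact_imp_closed)
  let ?U = "{p. infdist p P < infdist p Q}" and ?V = "{p. infdist p Q < infdist p P}"
  have "open ?U" "open ?V" by (intro open_Collect_less continuous_intros)+
  moreover have "P \<subseteq> ?U"
    using PQ infdist_pos_not_in_closed[of Q] by (metis (no_types, lifting) disjoint_iff infdist_zero mem_Collect_eq subsetI)
  moreover have "Q \<subseteq> ?V"
    using PQ infdist_pos_not_in_closed[of P] by (metis (no_types, lifting) disjoint_iff infdist_zero mem_Collect_eq subsetI)
  ultimately show thesis
    using that[of ?U ?V] PQ by fastforce
qed

text \<open>The condition puts \<open>of_int j + x\<close> into
  \<open>{\<theta> - 3/4..\<theta> - 1/4}\<close>. One half of this interval lies between
  consecutive integers: the upper half if the fractional part of \<open>\<theta>\<close> is at least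
  1/2, the lower half otherwise.\<close>

lemma quarter_interval_in_middle_half:
  fixes \<theta> :: real
  obtains c and j :: int where "0 \<le> c" "c + 1/4 \<le> 1"
    and "\<forall>x\<in>{c..c + 1/4}. of_int j + x + 1/4 \<le> \<theta> \<and> \<theta> \<le> of_int j + x + 3/4"
proof (cases "\<theta> - of_int \<lfloor>\<theta>\<rfloor> \<ge> 1/2")
  case True
  then show thesis
    using that[of "\<theta> - of_int \<lfloor>\<theta>\<rfloor> - 1/2" "\<lfloor>\<theta>\<rfloor>"] floor_correct[of \<theta>] by auto
next
  case False
  then show thesis
    using that[of "\<theta> - of_int \<lfloor>\<theta>\<rfloor> + 1/4" "\<lfloor>\<theta>\<rfloor> - 1"] floor_correct[of \<theta>] by auto
qed

text \<open>Disjoint open sets \<open>A\<close> and \<open>B\<close> split the fibre, and by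
  compactness they cover the preimage of a thin slab around \<open>w\<close>. Hence fibre points in
  \<open>A\<close> and in \<open>B\<close> lie in different components.\<close>

lemma len_segment_less_fibre:
  fixes \<gamma> :: "'a::metric_space \<Rightarrow> 'b::euclidean_space"
  assumes path: "generalized_path X \<gamma>" and image: "\<gamma> ` X = closed_segment z1 z2"
    and w: "w \<in> closed_segment z1 z2" "\<not> connected {p \<in> X. \<gamma> p = w}"
  shows "len {0..1} (linepath z1 z2) < len X \<gamma>"
proof -
  have z: "z1 \<in> \<gamma> ` X" "z2 \<in> \<gamma> ` X" using image by auto
  have X: "compact X" "connected X" "continuous_on X \<gamma>"
    and cont: "\<And>u. continuous_on X (\<lambda>p. \<gamma> p \<bullet> u)"
    using path by (auto simp: generalized_path_def intro!: continuous_intros)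
  define v where "v = z2 - z1"
  have v: "v \<noteq> 0"
  \<comment> \<open>For equal endpoints \<open>\<gamma>\<close> is constant and the fibre is the
    connected set \<open>X\<close>.\<close>
  proof
    assume "v = 0"
    then have "\<gamma> ` X = {w}" using image w(1) by (simp add: v_def)
    then have "{p \<in> X. \<gamma> p = w} = X" by auto
    then show False using w(2) X(2) by simp
  qed
  have "closedin (top_of_set X) {p \<in> X. \<gamma> p = w}"
    using continuous_closedin_preimage_constant[OF X(3)] by simp
  then have "compact {p \<in> X. \<gamma> p = w}" using X(1) closedin_compact by blast
  from compact_disconnected_split[OF this w(2)]
  obtain A B where AB: "open A" "open B" "A \<inter> B = {}" "{p \<in> X. \<gamma> p = w} \<subseteq> A \<union> B"
      "A \<inter> {p \<in> X. \<gamma> p = w} \<noteq> {}" "B \<inter> {p \<in> X. \<gamma> p = w} \<noteq> {}" by blast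
  \<comment> \<open>The minimal distance from \<open>w\<close> over the part of \<open>X\<close>
    outside \<open>A\<close> and \<open>B\<close>, or an arbitrary 1 if that part is empty.\<close>
  obtain r where r: "0 < r" "\<And>p. p \<in> X \<Longrightarrow> dist (\<gamma> p) w < r \<Longrightarrow> p \<in> A \<union> B"
  proof (cases "X - (A \<union> B) = {}")
    case True
    then show thesis using that[of 1] by auto
  next
    case False
    have "compact (X - (A \<union> B))" using X(1) AB(1,2) by (intro compact_diff) auto
    moreover have "continuous_on (X - (A \<union> B)) (\<lambda>p. dist (\<gamma> p) w)"
      by (intro continuous_intros continuous_on_subset[OF X(3)]) auto
    ultimately obtain q where q: "q \<in> X - (A \<union> B)" "\<And>p. p \<in> X - (A \<union> B) \<Longrightarrow> dist (\<gamma> q) w \<le> dist (\<gamma> p) w"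
      using False continuous_attains_inf[of "X - (A \<union> B)" "\<lambda>p. dist (\<gamma> p) w"] by blast
    have "0 < dist (\<gamma> q) w" using q(1) AB(4) by auto
    then show thesis using that[of "dist (\<gamma> q) w"] q(2) by (meson DiffI not_le)
  qed
  \<comment> \<open>In these directions the projection shrinks distances along the segment by a
    factor below 2.\<close>
  define U where "U = {u. v \<bullet> u > norm v / 2}"
  \<comment> \<open>The bound \<open>r / 3\<close> ensures \<open>2 * \<mu> < r\<close>, and
    \<open>norm v / 4\<close> makes a slab too thin to contain both endpoints.\<close>
  define m where "m = min 1 (min (r / 3) (norm v / 4))"
  have m: "0 < m" "m \<le> 1" "m \<le> r / 3" "m \<le> norm v / 4" using r(1) v by (auto simp: m_def)
  define N where "N = nat \<lceil>norm (z2 - z1) / (m / 2) + 2\<rceil>"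
  obtain s where s: "w = z1 + s *\<^sub>R v"
    using w(1) by (auto simp: closed_segment_def v_def algebra_simps)
  have near: "dist (\<gamma> p) w \<le> 2 * \<bar>\<gamma> p \<bullet> u - w \<bullet> u\<bar>" if "p \<in> X" "u \<in> U" for p u
  proof -
    have "\<gamma> p \<in> closed_segment z1 z2" using image that(1) by blast
    then obtain t where t: "\<gamma> p = z1 + t *\<^sub>R v"
      by (auto simp: closed_segment_def v_def algebra_simps)
    have "dist (\<gamma> p) w = \<bar>t - s\<bar> * norm v"
      by (simp add: t s dist_norm scaleR_diff_left[symmetric])
    also have "\<dots> \<le> \<bar>t - s\<bar> * (2 * \<bar>v \<bullet> u\<bar>)"
      using that(2) by (intro mult_left_mono) (auto simp: U_def)
    also have "\<dots> = 2 * \<bar>\<gamma> p \<bullet> u - w \<bullet> u\<bar>"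
      by (simp add: t s inner_add_left abs_mult[symmetric] algebra_simps)
    finally show ?thesis .
  qed
  show ?thesis
  proof (rule len_segment_less[OF path z, where m = m and \<delta> = "(1/2) ^ N * (m / 8)"])
    show "open U" unfolding U_def by (rule open_halfspace_gt)
    show "sgn v \<in> U" using v by (simp add: U_def sgn_div_norm dot_square_norm power2_eq_square field_simps)
    show "norm (sgn v) = 1" using v by (simp add: norm_sgn)
    show "0 < (1/2) ^ N * (m / 8)" using m by simp
    show "\<exists>c. 0 \<le> c \<and> c + 1/4 \<le> 1 \<and> (\<forall>x\<in>{c..c + 1/4}.
        slab_length {0..1} (linepath z1 z2) x u \<mu> + ennreal ((1/2) ^ N * (m / 8)) \<le> slab_length X \<gamma> x u \<mu>)"
      if \<mu>: "m / 2 \<le> \<mu>" "\<mu> \<le> m" and u: "u \<in> U" "norm u = 1" for \<mu> u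
    proof -
      have \<mu>0: "0 < \<mu>" using \<mu> m by simp
      obtain c and j :: int where c: "0 \<le> c" "c + 1/4 \<le> 1"
        and cj: "\<forall>x\<in>{c..c + 1/4}.
          of_int j + x + 1/4 \<le> w \<bullet> u / \<mu> \<and> w \<bullet> u / \<mu> \<le> of_int j + x + 3/4"
        by (rule quarter_interval_in_middle_half[of "w \<bullet> u / \<mu>"])
      have "slab_length {0..1} (linepath z1 z2) x u \<mu> + ennreal ((1/2) ^ N * (m / 8)) \<le> slab_length X \<gamma> x u \<mu>"
        if x: "x \<in> {c..c + 1/4}" for x
      proof -
        define l where "l = \<mu> * (of_int j + x)"
        have l': "\<mu> * (of_int j + 1 + x) = l + \<mu>" by (simp add: l_def algebra_simps)
        have y: "l + \<mu> / 4 \<le> w \<bullet> u" "w \<bullet> u \<le> l + \<mu> - \<mu> / 4"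
          using bspec[OF cj x] \<mu>0 by (auto simp: l_def field_simps)
        let ?K = "{p \<in> X. \<gamma> p \<bullet> u \<in> {l..l + \<mu>}}"
        have KAB: "?K \<subseteq> A \<union> B"
        proof
          fix p assume "p \<in> ?K"
          then have p: "p \<in> X" "\<bar>\<gamma> p \<bullet> u - w \<bullet> u\<bar> \<le> \<mu>" using y \<mu>0 by auto
          have "dist (\<gamma> p) w \<le> 2 * \<mu>"
            by (rule order_trans[OF near[OF p(1) u(1)]]) (use p(2) in simp)
          also have "\<dots> < r" using \<mu> m r(1) by linarith
          finally show "p \<in> A \<union> B" using r(2) p(1) by blast
        qed
        obtain q where q: "q \<in> X" "\<gamma> q \<bullet> u \<notin> {l..l + \<mu>}"
        proof -
          obtain q1 q2 where q12: "q1 \<in> X" "q2 \<in> X" "\<gamma> q1 = z1" "\<gamma> q2 = z2" using z by blast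
          have "z2 \<bullet> u - z1 \<bullet> u > \<mu>"
            using u(1) \<mu> m by (auto simp: U_def v_def inner_diff_left)
          then have "z1 \<bullet> u \<notin> {l..l + \<mu>} \<or> z2 \<bullet> u \<notin> {l..l + \<mu>}" by auto
          then show thesis using that q12 by metis
        qed
        \<comment> \<open>\<open>w\<close> is at least \<open>\<mu> / 4\<close> away from both faces
          of the slab, and \<open>\<mu> \<ge> m / 2\<close>.\<close>
        have wide: "m / 8 \<le> width u (\<gamma> ` D)" if D: "D \<in> components ?K" "p \<in> D" "\<gamma> p = w" for D p
        proof -
          obtain p' where p': "p' \<in> D" "\<gamma> p' \<bullet> u = l \<or> \<gamma> p' \<bullet> u = l + \<mu>"
            by (rule component_reaches_boundary[OF X(1,2) cont q D(1)])
          have "D \<subseteq> X" using D(1) in_components_subset by blast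
          from abs_inner_diff_le_width[OF path this p'(1) D(2), of u]
          show ?thesis using p'(2) D(3) y \<mu> by auto
        qed
        have fibre_sub: "p \<in> ?K" if "p \<in> X" "\<gamma> p = w" for p using that y \<mu>0 by auto
        obtain a where a: "a \<in> A" "a \<in> X" "\<gamma> a = w" using AB(5) by blast
        obtain b where b: "b \<in> B" "b \<in> X" "\<gamma> b = w" using AB(6) by blast
        obtain D1 where D1: "D1 \<in> components ?K" "a \<in> D1"
          using fibre_sub[OF a(2,3)] Union_components[of ?K] by blast
        obtain D2 where D2: "D2 \<in> components ?K" "b \<in> D2"
          using fibre_sub[OF b(2,3)] Union_components[of ?K] by blast
        have "D1 \<noteq> D2"
        proof
          assume "D1 = D2"
          moreover have "connected D1" "D1 \<subseteq> A \<union> B"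
            using D1(1) KAB in_components_connected in_components_subset by blast+
          ultimately show False
            using connectedD[of D1 A B] AB(1-3) a(1) b(1) D1(2) D2(2) by blast
        qed
        show ?thesis
        proof (rule slab_length_segment_plus_extra_le[OF path z \<mu>0 u(2), where \<D> = "{D1, D2}" and j = j])
          have "norm (z2 - z1) / \<mu> \<le> norm (z2 - z1) / (m / 2)"
            using \<mu> m by (intro divide_left_mono) auto
          then show "norm (z2 - z1) / \<mu> + 2 \<le> real N" unfolding N_def by linarith
          show "{D1, D2} \<subseteq> components {p \<in> X. \<gamma> p \<in> slab x u \<mu> j}"
            using D1(1) D2(1) by (simp add: slab_preimage_eq l' l_def[symmetric])
          show "m / 8 \<le> width u (\<gamma> ` D)" if "D \<in> {D1, D2}" for D
            using that wide[OF D1 a(3)] wide[OF D2 b(3)] by auto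
          show "{t \<in> {0..1}. linepath z1 z2 t \<in> slab x u \<mu> j} = {} \<or> (\<exists>D\<in>{D1, D2}. D \<noteq> D1)"
            using \<open>D1 \<noteq> D2\<close> by auto
        qed (use m in auto)
      qed
      with c show ?thesis by blast
    qed
  qed (use m in auto)
qed

section \<open>The inequality and its two strict cases\<close>

theorem proposition6:
  fixes X :: "'a::metric_space set" and \<gamma> :: "'a \<Rightarrow> real ^ 'n" and z1 z2 :: "real ^ 'n"
  assumes "CARD('n) \<ge> 2"
    and "generalized_path X \<gamma>"
    and "z1 \<in> \<gamma> ` X" and "z2 \<in> \<gamma> ` X"
  shows "len {0..1} (linepath z1 z2) \<le> len X \<gamma> \<and>
    (\<gamma> ` X \<noteq> closed_segment z1 z2 \<or>
       (\<exists>w \<in> closed_segment z1 z2. \<not> connected {p \<in> X. \<gamma> p = w}) \<longrightarrow>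
     len {0..1} (linepath z1 z2) < len X \<gamma>)"
proof (intro conjI impI)
  show "len {0..1} (linepath z1 z2) \<le> len X \<gamma>"
    by (rule len_segment_le[OF assms(2-4)])
next
  assume *: "\<gamma> ` X \<noteq> closed_segment z1 z2 \<or>
       (\<exists>w \<in> closed_segment z1 z2. \<not> connected {p \<in> X. \<gamma> p = w})"
  show "len {0..1} (linepath z1 z2) < len X \<gamma>"
  proof (cases "\<gamma> ` X \<subseteq> closed_segment z1 z2")
    case False
    then obtain w where "w \<in> \<gamma> ` X" "w \<notin> closed_segment z1 z2" by blast
    then show ?thesis by (rule len_segment_less_outside[OF assms(2-4)])
  next
    case True
    \<comment> \<open>A connected subset of a line is convex, so the image fills the segment and
      only the alternative about fibres remains.\<close>
    have "connected (\<gamma> ` X)"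
      using assms(2) by (auto simp: generalized_path_def intro: connected_continuous_image)
    then have "convex (\<gamma> ` X)"
      using convex_connected_collinear collinear_subset[OF collinear_closed_segment True] by blast
    then have "closed_segment z1 z2 \<subseteq> \<gamma> ` X"
      using assms(3,4) by (rule closed_segment_subset[rotated 2])
    with True have image: "\<gamma> ` X = closed_segment z1 z2" by blast
    with * obtain w where "w \<in> closed_segment z1 z2" "\<not> connected {p \<in> X. \<gamma> p = w}" by blast
    then show ?thesis by (rule len_segment_less_fibre[OF assms(2) image])
  qed
qed

end
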